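(* Let $K/\mathbb{Q}$ be a finite Galois extension, let $G$ be its Galois group, let $\chi_1,\ldots,\chi_r$ be the irreducible characters of $G$, and let $f_j=L(s,\chi_j,K/\mathbb{Q})$, $j=1,\ldots,r$, be the corresponding Artin $L$-functions. Let $s_0\in\mathbb{C}$ with $s_0\neq 1$. Let $Ar=\{f_1^{k_1}\cdots f_r^{k_r}\mid k_1\geq 0,\ldots,k_r\geq 0\}$ (with integer exponents) be the multiplicative semigroup of all Artin $L$-functions, and let $\mathit{Hol}(s_0)\subseteq Ar$ be the subsemigroup consisting of the $L$-functions in $Ar$ that are holomorphic at $s_0$. Then the following assertions are equivalent: (i) Artin's conjecture is true: $\mathit{Hol}(s_0)=Ar$. (ii) The semigroup $\mathit{Hol}(s_0)$ is factorial, and for every $k,l\in\{1,\ldots,r\}$ with $k\neq l$ there exists $f\in\mathit{Hol}(s_0)$ such that $f_k\mid f$ and $f_l\nmid f$. (iii) The semigroup $\mathit{Hol}(s_0)$ is factorial, and there exists an integer $m$ with $1\leq m<r$ such that for every set $M\subseteq\{1,\ldots,r\}$ with $m$ elements and for every $j\in M$ there exists an integer $k_j>0$ such that $\prod_{j\in M}f_j^{k_j}\in\mathit{Hol}(s_0)$.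
   Context: The Artin $L$-functions $L(s,\chi,K/\mathbb{Q})$ are regarded as meromorphic functions on $\mathbb{C}$; with $d_j=\chi_j(1)$ the Dedekind zeta function of $K$ is $\zeta_K(s)=f_1^{d_1}\cdots f_r^{d_r}$. By a theorem of Artin, $f_1,\ldots,f_r$ are multiplicatively independent (a relation $f_1^{k_1}\cdots f_r^{k_r}=1$ with $k_1,\ldots,k_r\in\mathbb{Z}$ implies $k_1=\cdots=k_r=0$), so $Ar$ is a free (commutative) semigroup on the generators $f_1,\ldots,f_r$. Divisibility is taken in $Ar$: for $f,g\in Ar$, $f\mid g$ means that there exists $h\in Ar$ with $g=fh$. The only invertible element of $\mathit{Hol}(s_0)$ is the identity $1$. An element of $\mathit{Hol}(s_0)$ is irreducible if it is not $1$ and is not a product of two non-identity elements of $\mathit{Hol}(s_0)$. Every element of $\mathit{Hol}(s_0)$ is a product of irreducible elements, and the set of irreducible elements (the Hilbert basis of $\mathit{Hol}(s_0)$) is finite and has at least $r$ elements. The semigroup $\mathit{Hol}(s_0)$ is called factorial if every element factors into irreducible elements of $\mathit{Hol}(s_0)$ uniquely up to order; this holds if and only if $\mathit{Hol}(s_0)$ has exactly $r$ irreducible elements.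
   Formalization: The equivalence of (i) with (iii) is stated only for r > 1: for K = Q (r = 1) assertion (i) holds, since the Riemann zeta function is holomorphic away from 1, but (iii) fails because no integer m satisfies 1 ≤ m < 1. The equivalence of (i) and (ii) is stated for all r. *)

theory Defs
  imports
    "HOL-Complex_Analysis.Complex_Analysis"
    "HOL-Algebra.Divisibility"
    "HOL-Algebra.Ideal"
    "Jordan_Normal_Form.Determinant"
begin

section \<open>The Galois group of a number field\<close>

text \<open>
  The number field \<open>K\<close> is the universe of a type \<open>'k\<close> of characteristic 0, and the field of
  rational numbers inside it is the set \<open>\<rat>\<close>. Field automorphisms fix \<open>\<rat>\<close> automatically.
\<close>

definition galois_group :: "('k::field_char_0 \<Rightarrow> 'k) set" where
  "galois_group =
     {\<sigma>. bij \<sigma> \<and> (\<forall>x y. \<sigma> (x + y) = \<sigma> x + \<sigma> y) \<and> (\<forall>x y. \<sigma> (x * y) = \<sigma> x * \<sigma> y)}"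

definition finite_galois_over_rat :: "'k::field_char_0 itself \<Rightarrow> bool" where
  "finite_galois_over_rat _ \<longleftrightarrow>
     (\<exists>B::'k set. finite B \<and> module.span (\<lambda>(q::rat) x. of_rat q * x) B = UNIV) \<and>
     {x::'k. \<forall>\<sigma>\<in>galois_group. \<sigma> x = x} = \<rat>"

definition integer_ring :: "'k::field_char_0 ring" where
  "integer_ring = \<lparr>carrier = {x. algebraic_int x}, mult = (*), one = 1, zero = 0, add = (+)\<rparr>"

definition prime_above :: "nat \<Rightarrow> 'k::field_char_0 set \<Rightarrow> bool" where
  "prime_above p P \<longleftrightarrow> primeideal P integer_ring \<and> of_nat p \<in> P"

definition decomposition_group :: "'k::field_char_0 set \<Rightarrow> ('k \<Rightarrow> 'k) set" where
  "decomposition_group P = {\<sigma>\<in>galois_group. \<sigma> ` P = P}"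

definition inertia_group :: "'k::field_char_0 set \<Rightarrow> ('k \<Rightarrow> 'k) set" where
  "inertia_group P =
     {\<sigma>\<in>decomposition_group P. \<forall>x\<in>carrier integer_ring. \<sigma> x - x \<in> P}"

text \<open>
  The arithmetic Frobenius automorphisms at a prime ideal \<open>P\<close> above \<open>p\<close>; they form a coset of the
  inertia group.
\<close>

definition is_frobenius :: "nat \<Rightarrow> 'k::field_char_0 set \<Rightarrow> ('k \<Rightarrow> 'k) \<Rightarrow> bool" where
  "is_frobenius p P \<phi> \<longleftrightarrow>
     \<phi> \<in> decomposition_group P \<and> (\<forall>x\<in>carrier integer_ring. \<phi> x - x ^ p \<in> P)"

section \<open>Complex representations and irreducible characters\<close>

definition representation :: "nat \<Rightarrow> (('k::field_char_0 \<Rightarrow> 'k) \<Rightarrow> complex mat) \<Rightarrow> bool" where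
  "representation n \<rho> \<longleftrightarrow>
     (\<forall>\<sigma>\<in>galois_group. \<rho> \<sigma> \<in> carrier_mat n n) \<and> \<rho> id = 1\<^sub>m n \<and>
     (\<forall>\<sigma>\<in>galois_group. \<forall>\<tau>\<in>galois_group. \<rho> (\<sigma> \<circ> \<tau>) = \<rho> \<sigma> * \<rho> \<tau>)"

text \<open>Characters are functions on the Galois group, made extensional outside of it.\<close>

definition rep_character ::
    "nat \<Rightarrow> (('k::field_char_0 \<Rightarrow> 'k) \<Rightarrow> complex mat) \<Rightarrow> ('k \<Rightarrow> 'k) \<Rightarrow> complex" where
  "rep_character n \<rho> = restrict (\<lambda>\<sigma>. \<Sum>i<n. \<rho> \<sigma> $$ (i, i)) galois_group"

definition invariant_subspace ::
    "nat \<Rightarrow> (('k::field_char_0 \<Rightarrow> 'k) \<Rightarrow> complex mat) \<Rightarrow> complex vec set \<Rightarrow> bool" where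
  "invariant_subspace n \<rho> W \<longleftrightarrow>
     W \<subseteq> carrier_vec n \<and> 0\<^sub>v n \<in> W \<and> (\<forall>v\<in>W. \<forall>w\<in>W. v + w \<in> W) \<and>
     (\<forall>c. \<forall>v\<in>W. c \<cdot>\<^sub>v v \<in> W) \<and> (\<forall>\<sigma>\<in>galois_group. \<forall>v\<in>W. \<rho> \<sigma> *\<^sub>v v \<in> W)"

definition irreducible_representation ::
    "nat \<Rightarrow> (('k::field_char_0 \<Rightarrow> 'k) \<Rightarrow> complex mat) \<Rightarrow> bool" where
  "irreducible_representation n \<rho> \<longleftrightarrow>
     representation n \<rho> \<and> n > 0 \<and>
     (\<forall>W. invariant_subspace n \<rho> W \<longrightarrow> W = {0\<^sub>v n} \<or> W = carrier_vec n)"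

definition irreducible_characters :: "(('k::field_char_0 \<Rightarrow> 'k) \<Rightarrow> complex) set" where
  "irreducible_characters = {rep_character n \<rho> | n \<rho>. irreducible_representation n \<rho>}"

section \<open>Artin L-functions\<close>

definition inertia_invariants ::
    "nat \<Rightarrow> (('k::field_char_0 \<Rightarrow> 'k) \<Rightarrow> complex mat) \<Rightarrow> 'k set \<Rightarrow> complex vec set" where
  "inertia_invariants n \<rho> P = {v\<in>carrier_vec n. \<forall>\<tau>\<in>inertia_group P. \<rho> \<tau> *\<^sub>v v = v}"

text \<open>
  \<open>E\<close> is the function \<open>t \<mapsto> det (1 - t \<rho>(\<phi>) | V\<^sup>I)\<close>, where \<open>\<phi>\<close> is a Frobenius at a prime ideal \<open>P\<close>
  above \<open>p\<close> and \<open>V\<^sup>I\<close> is the space of vectors invariant under the inertia group of \<open>P\<close>. The columns of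
  \<open>B\<close> are a basis of \<open>V\<^sup>I\<close>, and \<open>C\<close> is the matrix of the restriction of \<open>\<rho>(\<phi>)\<close> to \<open>V\<^sup>I\<close> in this basis.
  The result depends neither on \<open>P\<close> and \<open>\<phi>\<close> nor on \<open>B\<close>.
\<close>

definition is_euler_factor ::
    "nat \<Rightarrow> (('k::field_char_0 \<Rightarrow> 'k) \<Rightarrow> complex mat) \<Rightarrow> nat \<Rightarrow> (complex \<Rightarrow> complex) \<Rightarrow> bool" where
  "is_euler_factor n \<rho> p E \<longleftrightarrow>
     (\<exists>P \<phi> m B C. prime_above p P \<and> is_frobenius p P \<phi> \<and>
        B \<in> carrier_mat n m \<and>
        bij_betw (\<lambda>v. B *\<^sub>v v) (carrier_vec m) (inertia_invariants n \<rho> P) \<and>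
        C \<in> carrier_mat m m \<and> \<rho> \<phi> * B = B * C \<and>
        E = (\<lambda>t. Determinant.det (1\<^sub>m m - t \<cdot>\<^sub>m C)))"

text \<open>
  Meromorphic functions on the complex plane are represented by their unique
  \<^const>\<open>nicely_meromorphic_on\<close> representative (removable singularities filled in, value 0 at poles),
  so that equality of meromorphic functions is equality in HOL. By the identity theorem the
  following predicate determines \<open>f\<close>: it is the meromorphic continuation of the Euler product of a
  representation with character \<open>chi\<close>.
\<close>

definition is_artin_L_function ::
    "(('k::field_char_0 \<Rightarrow> 'k) \<Rightarrow> complex) \<Rightarrow> (complex \<Rightarrow> complex) \<Rightarrow> bool" where
  "is_artin_L_function chi f \<longleftrightarrow>
     f nicely_meromorphic_on UNIV \<and>
     (\<exists>n \<rho> E. representation n \<rho> \<and> rep_character n \<rho> = chi \<and>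
        (\<forall>p::nat. Factorial_Ring.prime p \<longrightarrow> is_euler_factor n \<rho> p (E p)) \<and>
        (\<forall>s. Re s > 1 \<longrightarrow>
           (\<lambda>p::nat. if Factorial_Ring.prime p then inverse (E p (of_nat p powr (-s))) else 1)
             has_prod f s))"

section \<open>Semigroups of L-functions\<close>

text \<open>
  The product of powers as a meromorphic function; \<^const>\<open>remove_sings\<close> turns the pointwise product,
  which is wrong where zeros and poles cancel, into the representative described above.
\<close>

definition power_product ::
    "(nat \<Rightarrow> complex \<Rightarrow> complex) \<Rightarrow> nat set \<Rightarrow> (nat \<Rightarrow> int) \<Rightarrow> complex \<Rightarrow> complex" where
  "power_product f J k = remove_sings (\<lambda>s. \<Prod>j\<in>J. f j s powi k j)"

definition multiplicatively_independent ::
    "(nat \<Rightarrow> complex \<Rightarrow> complex) \<Rightarrow> nat set \<Rightarrow> bool" where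
  "multiplicatively_independent f J \<longleftrightarrow>
     (\<forall>k. power_product f J k = (\<lambda>_. 1) \<longrightarrow> (\<forall>j\<in>J. k j = 0))"

definition Ar :: "nat \<Rightarrow> (nat \<Rightarrow> complex \<Rightarrow> complex) \<Rightarrow> (complex \<Rightarrow> complex) monoid" where
  "Ar r f =
     \<lparr>carrier = {power_product f {1..r} k | k. \<forall>j\<in>{1..r}. k j \<ge> 0},
      mult = (\<lambda>g h. remove_sings (\<lambda>s. g s * h s)),
      one = (\<lambda>_. 1)\<rparr>"

definition Hol ::
    "nat \<Rightarrow> (nat \<Rightarrow> complex \<Rightarrow> complex) \<Rightarrow> complex \<Rightarrow> (complex \<Rightarrow> complex) monoid" where
  "Hol r f s0 = (Ar r f)\<lparr>carrier := {g \<in> carrier (Ar r f). g analytic_on {s0}}\<rparr>"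

end

theory Submission
  imports Defs "Jordan_Normal_Form.Spectral_Radius"
begin

text \<open>
  Let \<open>n\<^sub>j\<close> be the order of \<open>f\<^sub>j\<close> at \<open>s0\<close>. Exponent vectors identify \<open>Ar\<close> with \<open>\<nat>\<^sup>r\<close> and \<open>Hol(s0)\<close> with the
  vectors \<open>k\<close> such that \<open>\<Sum> n\<^sub>j k\<^sub>j \<ge> 0\<close>, and Artin's conjecture says that no \<open>n\<^sub>j\<close> is negative. If some \<open>n\<^sub>l\<close>
  is negative and \<open>Hol(s0)\<close> is factorial, then at most one \<open>n\<^sub>i\<close> is positive; an element of \<open>Hol(s0)\<close>
  divisible by \<open>f\<^sub>l\<close> is then divisible by this \<open>f\<^sub>i\<close> (and does not exist if there is no such \<open>i\<close>), which
  contradicts (ii) if \<open>r \<ge> 2\<close>, and (iii).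
  For \<open>r = 1\<close> the second condition of (ii) is void; here \<open>f\<^sub>1\<close> is the Riemann zeta function, and one
  needs that it continues holomorphically to \<open>\<complex> - {1}\<close>.
\<close>

section \<open>Monoids of exponent vectors of nonnegative weight\<close>

text \<open>Serves twice: with all weights 0 for \<open>Ar\<close>, and with the orders at
  \<open>s0\<close> as weights for \<open>Hol\<close>. Exponents are functions on the whole index
  type, of which only the values on \<open>J\<close> count.\<close>

locale weighted_monoid =
  fixes G :: "'a monoid" (structure) and J :: "'i set" and n :: "'i \<Rightarrow> int"
    and P :: "('i \<Rightarrow> int) \<Rightarrow> 'a"
  assumes finite_J: "finite J"
    and carrier_eq: "carrier G = {P k | k. (\<forall>j\<in>J. 0 \<le> k j) \<and> 0 \<le> (\<Sum>j\<in>J. n j * k j)}"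
    and mult_P: "P k \<otimes> P l = P (\<lambda>j. k j + l j)"
    and one_P: "\<one> = P (\<lambda>_. 0)"
    and P_eq_iff: "P k = P l \<longleftrightarrow> (\<forall>j\<in>J. k j = l j)"
begin

definition weight :: "('i \<Rightarrow> int) \<Rightarrow> int" where
  "weight k = (\<Sum>j\<in>J. n j * k j)"

definition admissible :: "('i \<Rightarrow> int) \<Rightarrow> bool" where
  "admissible k \<longleftrightarrow> (\<forall>j\<in>J. 0 \<le> k j) \<and> 0 \<le> weight k"

lemma weight_add: "weight (\<lambda>j. k j + l j) = weight k + weight l"
  by (simp add: weight_def distrib_left sum.distrib)

lemma weight_diff: "weight (\<lambda>j. k j - l j) = weight k - weight l"
  by (simp add: weight_def right_diff_distrib sum_subtractf)

lemma weight_cong: "(\<And>j. j \<in> J \<Longrightarrow> k j = l j) \<Longrightarrow> weight k = weight l"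
  by (simp add: weight_def)

lemma weight_single: "i \<in> J \<Longrightarrow> weight (\<lambda>j. if j = i then c else 0) = n i * c"
  using finite_J by (simp add: weight_def if_distrib[of "(*) _"] cong: if_cong)

lemma weight_pair:
  "i \<in> J \<Longrightarrow> l \<in> J \<Longrightarrow> i \<noteq> l \<Longrightarrow>
    weight (\<lambda>j. if j = i then c else if j = l then d else 0) = n i * c + n l * d"
proof -
  assume il: "i \<in> J" "l \<in> J" "i \<noteq> l"
  have "weight (\<lambda>j. if j = i then c else if j = l then d else 0) =
        weight (\<lambda>j. (if j = i then c else 0) + (if j = l then d else 0))"
    using il by (intro weight_cong) auto
  then show ?thesis
    using il by (simp only: weight_add weight_single)
qed

lemma admissible_add: "admissible k \<Longrightarrow> admissible l \<Longrightarrow> admissible (\<lambda>j. k j + l j)"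
  by (simp add: admissible_def weight_add)

lemma admissible_zero: "admissible (\<lambda>_. 0)"
  by (simp add: admissible_def weight_def)

lemma admissible_cong: "(\<And>j. j \<in> J \<Longrightarrow> k j = l j) \<Longrightarrow> admissible k \<longleftrightarrow> admissible l"
  using weight_cong[of k l] by (simp add: admissible_def)

lemma mem_carrier_iff: "P k \<in> carrier G \<longleftrightarrow> admissible k"
proof
  assume "P k \<in> carrier G"
  then obtain l where "P k = P l" "admissible l"
    by (auto simp: carrier_eq admissible_def weight_def)
  then show "admissible k"
    using admissible_cong[of k l] by (simp add: P_eq_iff)
qed (auto simp: carrier_eq admissible_def weight_def)

lemma carrierE:
  assumes "x \<in> carrier G"
  obtains k where "x = P k" "admissible k"
  using assms mem_carrier_iff by (auto simp: carrier_eq)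

sublocale comm_monoid_cancel G
proof (intro comm_monoid_cancelI comm_monoidI)
  show "x \<otimes> y \<in> carrier G" if "x \<in> carrier G" "y \<in> carrier G" for x y
    using that by (auto elim!: carrierE simp: mult_P mem_carrier_iff admissible_add)
  show "\<one> \<in> carrier G"
    by (simp add: one_P mem_carrier_iff admissible_zero)
  show "x \<otimes> y \<otimes> z = x \<otimes> (y \<otimes> z)" if "x \<in> carrier G" "y \<in> carrier G" "z \<in> carrier G" for x y z
    using that by (auto elim!: carrierE simp: mult_P add.assoc)
  show "\<one> \<otimes> x = x" if "x \<in> carrier G" for x
    using that by (auto elim!: carrierE simp: mult_P one_P)
  show "x \<otimes> y = y \<otimes> x" if "x \<in> carrier G" "y \<in> carrier G" for x y
    using that by (auto elim!: carrierE simp: mult_P add.commute)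
  show "x = y" if "x \<otimes> z = y \<otimes> z" "x \<in> carrier G" "y \<in> carrier G" "z \<in> carrier G" for x y z
    using that by (auto elim!: carrierE simp: mult_P P_eq_iff)
qed

section \<open>Divisibility and factoriality\<close>

text \<open>The quotient has exponents \<open>l j - k j\<close>, and these must be admissible. The
  weight condition separates divisibility in \<open>Hol\<close> from divisibility in
  \<open>Ar\<close>.\<close>

lemma divides_iff:
  "P k divides P l \<longleftrightarrow> (\<forall>j\<in>J. k j \<le> l j) \<and> weight k \<le> weight l"
proof
  assume "P k divides P l"
  then obtain d where "admissible d" "P l = P (\<lambda>j. k j + d j)"
    unfolding factor_def by (auto elim!: carrierE simp: mult_P)
  then show "(\<forall>j\<in>J. k j \<le> l j) \<and> weight k \<le> weight l"
    using weight_cong[of l "\<lambda>j. k j + d j"] by (auto simp: P_eq_iff admissible_def weight_add)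
next
  assume "(\<forall>j\<in>J. k j \<le> l j) \<and> weight k \<le> weight l"
  then have "P (\<lambda>j. l j - k j) \<in> carrier G"
    by (simp add: mem_carrier_iff admissible_def weight_diff)
  then show "P k divides P l"
    unfolding factor_def by (rule rev_bexI) (simp add: mult_P)
qed

lemma Units_iff:
  assumes "admissible k"
  shows "P k \<in> Units G \<longleftrightarrow> (\<forall>j\<in>J. k j = 0)"
proof
  assume "P k \<in> Units G"
  then have "P k divides \<one>"
    by (rule unit_divides) simp
  then show "\<forall>j\<in>J. k j = 0"
    using assms by (auto simp: one_P divides_iff admissible_def intro: antisym)
next
  assume "\<forall>j\<in>J. k j = 0"
  then have "P k = \<one>"
    by (simp add: one_P P_eq_iff)
  then show "P k \<in> Units G"
    by simp
qed

text \<open>The sum of the exponents is a natural number that drops strictly on passing to a proper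
  divisor.\<close>

lemma divisor_chain_condition: "divisor_chain_condition_monoid G"
proof unfold_locales
  \<comment> \<open>The degree has to be a function of the element, so an exponent vector is chosen;
    by \<open>P_eq_iff\<close> the choice does not affect its values on \<open>J\<close>.\<close>
  define deg where "deg x = nat (\<Sum>j\<in>J. (SOME k. P k = x) j)" for x
  have deg_P: "deg (P k) = nat (\<Sum>j\<in>J. k j)" for k
  proof -
    have "P (SOME l. P l = P k) = P k"
      by (rule someI[of _ k]) simp
    then have "\<forall>j\<in>J. (SOME l. P l = P k) j = k j"
      by (simp only: P_eq_iff)
    then show ?thesis
      by (simp add: deg_def)
  qed
  have "deg x < deg y" if xy: "x \<in> carrier G" "y \<in> carrier G" "properfactor G x y" for x y
  proof -
    obtain k l where k: "x = P k" "admissible k" and l: "y = P l" "admissible l"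
      using xy(1,2) by (meson carrierE)
    have le: "\<forall>j\<in>J. k j \<le> l j" and ndvd: "\<not> P l divides P k"
      using xy(3) by (auto simp: properfactor_def k l divides_iff)
    have "\<exists>j\<in>J. k j \<noteq> l j"
    proof (rule ccontr)
      assume "\<not> (\<exists>j\<in>J. k j \<noteq> l j)"
      then show False
        using ndvd weight_cong[of k l] by (simp add: divides_iff)
    qed
    then have "(\<Sum>j\<in>J. k j) < (\<Sum>j\<in>J. l j)"
      using le by (intro sum_strict_mono_ex1 finite_J) force+
    moreover have "0 \<le> (\<Sum>j\<in>J. k j)"
      using k by (intro sum_nonneg) (simp add: admissible_def)
    ultimately show ?thesis
      by (simp add: k l deg_P)
  qed
  then show "wf {(x, y). x \<in> carrier G \<and> y \<in> carrier G \<and> properfactor G x y}"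
    by (intro wf_subset[OF wf_measure[of deg]]) auto
qed

text \<open>The weight conditions now follow from those on the exponents, so the monoid is free. Its
  irreducible elements are the images of unit vectors, and these are prime.\<close>

lemma factorial_if_nonneg:
  assumes nonneg: "\<And>j. j \<in> J \<Longrightarrow> 0 \<le> n j"
  shows "factorial_monoid G"
proof -
  have weight_mono: "weight k \<le> weight l" if "\<forall>j\<in>J. k j \<le> l j" for k l
    using that nonneg by (auto simp: weight_def intro!: sum_mono mult_left_mono)
  have adm: "admissible k \<longleftrightarrow> (\<forall>j\<in>J. 0 \<le> k j)" for k
    using weight_mono[of "\<lambda>_. 0" k] by (auto simp: admissible_def weight_def)
  have dvd: "P k divides P l \<longleftrightarrow> (\<forall>j\<in>J. k j \<le> l j)" for k l
    using weight_mono by (auto simp: divides_iff)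
  have "Divisibility.prime G x" if x: "x \<in> carrier G" "Divisibility.irreducible G x" for x
  proof -
    obtain k where k: "x = P k" "admissible k"
      using x(1) by (rule carrierE)
    have "\<not> (\<forall>j\<in>J. k j = 0)"
      using x(2) k Units_iff unfolding Divisibility.irreducible_def by blast
    then obtain i where i: "i \<in> J" "k i \<noteq> 0"
      by blast
    \<comment> \<open>A generator occurring in \<open>x\<close>; irreducibility forces
      \<open>x\<close> to be this generator.\<close>
    define e where "e j = (if j = i then 1 else 0 :: int)" for j
    have e: "admissible e" "\<not> P e \<in> Units G"
      using i by (auto simp: adm e_def Units_iff)
    have k_nonneg: "\<forall>j\<in>J. 0 \<le> k j"
      using k by (simp add: admissible_def)
    have "P e divides P k"
      using i k_nonneg by (force simp: dvd e_def)
    moreover have "\<not> properfactor G (P e) x"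
      using x(2) e unfolding Divisibility.irreducible_def by (auto simp: mem_carrier_iff)
    ultimately have "P k divides P e"
      by (auto simp: properfactor_def k)
    then have x_eq: "x = P e"
      using \<open>P e divides P k\<close> by (auto simp: dvd P_eq_iff k intro: antisym)
    show ?thesis
      unfolding Divisibility.prime_def
    proof (intro conjI ballI impI)
      show "x \<notin> Units G"
        using e x_eq by simp
    next
      fix a b assume ab: "a \<in> carrier G" "b \<in> carrier G" "x divides a \<otimes> b"
      obtain s t where s: "a = P s" "admissible s" and t: "b = P t" "admissible t"
        using ab(1,2) by (meson carrierE)
      have "1 \<le> s i + t i"
        using ab(3) i by (auto simp: x_eq s t mult_P dvd e_def)
      then have "1 \<le> s i \<or> 1 \<le> t i"
        by linarith
      then show "x divides a \<or> x divides b"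
        using s t by (auto simp: x_eq dvd e_def adm)
    qed
  qed
  then have "primeness_condition_monoid G"
    by unfold_locales
  then show ?thesis
    using divisor_chain_condition factorial_condition_one by blast
qed

text \<open>
  With \<open>a = - n l\<close>, the elements \<open>u = x\<^sub>i^a * x\<^sub>l^(n i)\<close> and \<open>v = x\<^sub>j^a * x\<^sub>l^(n j)\<close> have weight 0 and
  \<open>u^(n j) * w = v^(n i) * x\<^sub>i^(a * n j)\<close> for \<open>w = x\<^sub>j^(a * n i)\<close>. So the irreducible element \<open>e = x\<^sub>i\<close>
  divides \<open>u^(n j) * w\<close>, but it divides neither a power of \<open>u\<close>, for reasons of weight, nor \<open>w\<close>.
\<close>

lemma positive_weight_unique:
  assumes fact: "factorial_monoid G"
    and l: "l \<in> J" "n l < 0" and i: "i \<in> J" "0 < n i" and j: "j \<in> J" "0 < n j"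
  shows "i = j"
proof (rule ccontr)
  assume "i \<noteq> j"
  define a where "a = - n l"
  define e where "e t = (if t = i then 1 else 0 :: int)" for t
  define u where "u t = (if t = i then a else if t = l then n i else 0)" for t
  define w where "w t = (if t = j then a * n i else 0)" for t
  have neq: "i \<noteq> l" "j \<noteq> l" and a: "0 < a"
    using i j l by (auto simp: a_def)
  have wt: "weight e = n i" "weight u = 0" "weight w = n j * (a * n i)"
    using weight_pair[OF i(1) l(1) neq(1), of a "n i"] weight_single[OF i(1), of 1]
      weight_single[OF j(1), of "a * n i"]
    by (simp_all add: e_def[abs_def] u_def[abs_def] w_def[abs_def] a_def)
  have adm: "admissible e" "admissible u" "admissible w"
    unfolding admissible_def wt using a i j by (auto simp: e_def u_def w_def)
  interpret factorial_monoid G by fact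
  \<comment> \<open>A proper divisor of \<open>P e\<close> has exponents between 0 and those of
    \<open>e\<close> but not all equal to them, hence is trivial; factoriality turns irreducible
    into prime.\<close>
  have prime: "Divisibility.prime G (P e)"
  proof (rule irreducible_prime)
    show "Divisibility.irreducible G (P e)"
      unfolding Divisibility.irreducible_def
    proof (intro conjI ballI impI)
      show "P e \<notin> Units G"
        using adm(1) i by (auto simp: Units_iff e_def)
    next
      fix b assume b: "b \<in> carrier G" "properfactor G b (P e)"
      obtain k where k: "b = P k" "admissible k"
        using b(1) by (rule carrierE)
      have le: "\<forall>t\<in>J. 0 \<le> k t \<and> k t \<le> e t" and ndvd: "\<not> P e divides P k"
        using b(2) k by (auto simp: properfactor_def divides_iff admissible_def)
      have "k i = 0"
      proof (rule ccontr)
        assume "k i \<noteq> 0"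
        then have "\<forall>t\<in>J. k t = e t"
          using le i by (force simp: e_def)
        then show False
          using ndvd weight_cong[of k e] by (simp add: divides_iff)
      qed
      then have "k t = 0" if "t \<in> J" for t
        using le that by (cases "t = i") (auto simp: e_def intro: antisym)
      then show "b \<in> Units G"
        using k by (simp add: Units_iff)
    qed
  qed (simp add: mem_carrier_iff adm)
  have power: "P k [^] m = P (\<lambda>t. int m * k t)" for k and m :: nat
    by (induction m) (simp_all add: one_P mult_P algebra_simps)
  \<comment> \<open>The quotient has weight \<open>n i * (n j * a) - n i\<close>, nonnegative
    because \<open>n j * a\<close> is at least 1.\<close>
  have "P e divides P u [^] nat (n j) \<otimes> P w"
  proof -
    have "weight (\<lambda>t. n j * u t + w t) = n j * weight u + weight w"
      by (simp add: weight_def sum.distrib sum_distrib_left algebra_simps)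
    moreover have "n i * 1 \<le> n i * (n j * a)"
      using a i j by (intro mult_left_mono) (simp_all add: zero_less_mult_iff less_imp_le int_one_le_iff_zero_less)
    moreover have "1 \<le> n j * a"
      using a j by (simp add: int_one_le_iff_zero_less)
    moreover have "\<forall>t\<in>J. e t \<le> n j * u t + w t"
      using a i j \<open>1 \<le> n j * a\<close> \<open>i \<noteq> j\<close> by (auto simp: e_def u_def w_def)
    ultimately show ?thesis
      using i j by (simp add: power mult_P divides_iff wt algebra_simps)
  qed
  then have "P e divides P u [^] nat (n j) \<or> P e divides P w"
    using prime adm unfolding Divisibility.prime_def by (auto simp: mem_carrier_iff)
  then show False
  proof
    assume "P e divides P u [^] nat (n j)"
    moreover have "weight (\<lambda>t. n j * u t) = n j * weight u"
      by (simp add: weight_def sum_distrib_left algebra_simps)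
    ultimately show False
      using i j by (simp add: power divides_iff wt)
  next
    assume "P e divides P w"
    then have "e i \<le> w i"
      using i by (simp add: divides_iff)
    then show False
      using \<open>i \<noteq> j\<close> by (simp add: e_def w_def)
  qed
qed

text \<open>The common obstruction to the separation condition in (ii) and to the products in (iii).
  Take for \<open>i\<close> the only index of positive weight, or any index other than
  \<open>l\<close> if there is none; without \<open>i\<close>, nothing compensates the negative
  contribution of \<open>l\<close>.\<close>

lemma positive_weight_escape:
  assumes fact: "factorial_monoid G" and card: "2 \<le> card J"
    and l: "l \<in> J" "n l < 0"
  obtains i where "i \<in> J" "i \<noteq> l"
    "\<forall>k. 0 < k l \<and> k i = 0 \<and> (\<forall>j\<in>J. 0 \<le> k j) \<longrightarrow> weight k < 0"
proof -
  have "J - {l} \<noteq> {}"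
    using card card_mono[of "{l}" J] by auto
  then obtain i0 where "i0 \<in> J" "i0 \<noteq> l"
    by blast
  have "\<exists>i\<in>J. i \<noteq> l \<and> (\<forall>j\<in>J. 0 < n j \<longrightarrow> j = i)"
  proof (cases "\<exists>i\<in>J. 0 < n i")
    case True
    then obtain i where i: "i \<in> J" "0 < n i"
      by blast
    then have "i \<noteq> l"
      using l(2) by auto
    with i show ?thesis
      using positive_weight_unique[OF fact l] by blast
  next
    case False
    then show ?thesis
      using \<open>i0 \<in> J\<close> \<open>i0 \<noteq> l\<close> by blast
  qed
  then obtain i where i: "i \<in> J" "i \<noteq> l" "\<And>j. j \<in> J \<Longrightarrow> 0 < n j \<Longrightarrow> j = i"
    by blast
  have neg: "weight k < 0" if k: "0 < k l" "k i = 0" "\<forall>j\<in>J. 0 \<le> k j" for k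
  proof -
    have "n j * k j \<le> 0" if "j \<in> J" for j
      using i(3)[OF that] k(2) k(3)[rule_format, OF that]
      by (cases "0 < n j") (auto simp: mult_nonpos_nonneg)
    moreover have "n l * k l < 0"
      using l k(1) by (simp add: mult_neg_pos)
    ultimately have "weight k < (\<Sum>j\<in>J. 0)"
      unfolding weight_def using l(1) by (intro sum_strict_mono_ex1 finite_J) auto
    then show ?thesis
      by simp
  qed
  show ?thesis
  proof (rule that)
    show "\<forall>k. 0 < k l \<and> k i = 0 \<and> (\<forall>j\<in>J. 0 \<le> k j) \<longrightarrow> weight k < 0"
      using neg by blast
  qed (use i in auto)
qed

end

section \<open>Products of powers of meromorphic functions\<close>

lemma remove_sings_nicely_meromorphic_id:
  assumes "f nicely_meromorphic_on UNIV"
  shows "remove_sings f = f"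
proof
  fix z
  from assms have "is_pole f z \<and> f z = 0 \<or> f \<midarrow>z\<rightarrow> f z"
    by (auto simp: nicely_meromorphic_on_def)
  then show "remove_sings f z = f z"
    by auto
qed

text \<open>By the identity theorem, zeros accumulating at \<open>z\<close> would make
  \<open>f\<close> vanish everywhere.\<close>

lemma nicely_meromorphic_eventually_nonzero:
  assumes "f nicely_meromorphic_on UNIV" "f w \<noteq> 0"
  shows "\<forall>\<^sub>F s in at z. f s \<noteq> 0"
  using frequently_eq_meromorphic_imp_constant[of f 0 z UNIV w] assms
  by (auto simp: frequently_def)

text \<open>Brings the products over subsets \<open>M\<close> in (iii) into the form with exponents
  on the full index set.\<close>

lemma power_product_subset:
  assumes "finite J" "M \<subseteq> J"
  shows "power_product f M k = power_product f J (\<lambda>j. if j \<in> M then k j else 0)"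
proof -
  have "(\<Prod>j\<in>J. f j s powi (if j \<in> M then k j else 0)) = (\<Prod>j\<in>M. f j s powi k j)" for s
    using assms by (intro prod.mono_neutral_cong_right) auto
  then show ?thesis
    by (simp add: power_product_def)
qed

lemma power_product_cong:
  "(\<And>j. j \<in> J \<Longrightarrow> k j = l j) \<Longrightarrow> power_product f J k = power_product f J l"
  by (simp add: power_product_def)

lemma power_product_zero: "power_product f J (\<lambda>_. 0) = (\<lambda>_. 1)"
  by (simp add: power_product_def fun_eq_iff)

lemma power_product_single:
  assumes "f j nicely_meromorphic_on UNIV"
  shows "power_product f {j} (\<lambda>_. 1) = f j"
  using remove_sings_nicely_meromorphic_id[OF assms] by (simp add: power_product_def)

text \<open>By \<open>nonzero\<close>, every point has a punctured neighbourhood on which no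
  \<open>f j\<close> takes the value 0. There the exponent laws for \<open>powi\<close> hold
  pointwise; at the value 0 they can fail, as \<open>inverse 0 = 0\<close>.\<close>

locale meromorphic_family =
  fixes J :: "nat set" and f :: "nat \<Rightarrow> complex \<Rightarrow> complex"
  assumes finite_J: "finite J"
    and mero: "j \<in> J \<Longrightarrow> f j nicely_meromorphic_on UNIV"
    and nonzero: "j \<in> J \<Longrightarrow> \<exists>s. f j s \<noteq> 0"
begin

lemma eventually_nonzero: "\<forall>\<^sub>F s in at z. \<forall>j\<in>J. f j s \<noteq> 0"
  using nicely_meromorphic_eventually_nonzero mero nonzero finite_J
  by (intro eventually_ball_finite) blast+

lemma mero': "j \<in> J \<Longrightarrow> f j meromorphic_on A"
  using mero[of j] by (auto simp: nicely_meromorphic_on_def intro: meromorphic_on_subset)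

lemma prod_mero: "(\<lambda>s. \<Prod>j\<in>J. f j s powi k j) meromorphic_on A"
  by (intro meromorphic_intros mero')

lemma power_product_mero: "power_product f J k nicely_meromorphic_on UNIV"
  unfolding power_product_def by (intro remove_sings_nicely_meromorphic prod_mero)

lemma eventually_power_product:
  "\<forall>\<^sub>F s in at z. power_product f J k s = (\<Prod>j\<in>J. f j s powi k j)"
  unfolding power_product_def
  by (intro eventually_remove_sings_eq_at meromorphic_on_isolated_singularity prod_mero)

text \<open>The pointwise identity may fail at zeros and poles, but it holds on punctured
  neighbourhoods, and \<open>remove_sings\<close> depends only on those.\<close>

lemma power_product_mult:
  "remove_sings (\<lambda>s. power_product f J k s * power_product f J l s) =
    power_product f J (\<lambda>j. k j + l j)"
proof
  fix z
  have "\<forall>\<^sub>F s in at z. power_product f J k s * power_product f J l s =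
          (\<Prod>j\<in>J. f j s powi (k j + l j))"
    using eventually_power_product[of k z] eventually_power_product[of l z] eventually_nonzero[of z]
    by eventually_elim (simp add: power_int_add prod.distrib)
  then show "remove_sings (\<lambda>s. power_product f J k s * power_product f J l s) z =
      power_product f J (\<lambda>j. k j + l j) z"
    unfolding power_product_def by (rule remove_sings_cong) simp
qed

text \<open>The quotient of equal products is 1, so independence applies to the exponents
  \<open>k j - l j\<close>.\<close>

lemma power_product_eq_iff:
  assumes "multiplicatively_independent f J"
  shows "power_product f J k = power_product f J l \<longleftrightarrow> (\<forall>j\<in>J. k j = l j)"
proof
  assume eq: "power_product f J k = power_product f J l"
  have "power_product f J (\<lambda>j. k j - l j) = (\<lambda>_. 1)"
  proof
    fix z
    have "\<forall>\<^sub>F s in at z. (\<Prod>j\<in>J. f j s powi (k j - l j)) = 1"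
      using eventually_power_product[of k z] eventually_power_product[of l z] eventually_nonzero[of z]
    proof eventually_elim
      case (elim s)
      then have "(\<Prod>j\<in>J. f j s powi k j) = (\<Prod>j\<in>J. f j s powi l j)"
        by (simp add: eq)
      with elim(3) finite_J show ?case
        by (simp add: power_int_diff prod_dividef)
    qed
    then have "power_product f J (\<lambda>j. k j - l j) z = remove_sings (\<lambda>_. 1) z"
      unfolding power_product_def by (rule remove_sings_cong) simp
    then show "power_product f J (\<lambda>j. k j - l j) z = 1"
      by simp
  qed
  then have "\<forall>j\<in>J. k j - l j = 0"
    using assms unfolding multiplicatively_independent_def by blast
  then show "\<forall>j\<in>J. k j = l j"
    by simp
qed (blast intro: power_product_cong)

text \<open>The sum is the order of the product at \<open>z\<close>. A normalized meromorphic
  function that is not locally zero is analytic at \<open>z\<close> exactly if it has no pole there,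
  that is, if its order is nonnegative.\<close>

lemma power_product_analytic_iff:
  "power_product f J k analytic_on {z} \<longleftrightarrow> 0 \<le> (\<Sum>j\<in>J. zorder (f j) z * k j)"
proof -
  let ?g = "power_product f J k"
  let ?F = "\<lambda>s. \<Prod>j\<in>J. f j s powi k j"
  have nz: "\<forall>\<^sub>F s in at z. ?F s \<noteq> 0"
    using eventually_nonzero[of z] by eventually_elim (simp add: finite_J)
  have g_nz: "\<forall>\<^sub>F s in at z. ?g s \<noteq> 0"
    using nz eventually_power_product[of k z] by eventually_elim simp
  have "zorder ?g z = zorder ?F z"
    by (intro zorder_cong eventually_power_product) simp
  also have "\<dots> = (\<Sum>j\<in>J. zorder (\<lambda>s. f j s powi k j) z)"
    by (intro zorder_prod nz meromorphic_intros mero')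
  also have "\<dots> = (\<Sum>j\<in>J. zorder (f j) z * k j)"
  proof (intro sum.cong refl)
    fix j assume "j \<in> J"
    then have "\<forall>\<^sub>F s in at z. f j s \<noteq> 0"
      using eventually_nonzero[of z] by (auto elim: eventually_mono)
    then show "zorder (\<lambda>s. f j s powi k j) z = zorder (f j) z * k j"
      using zorder_power_int[OF mero'[OF \<open>j \<in> J\<close>]] by (simp add: eventually_frequently)
  qed
  finally have order: "zorder ?g z = (\<Sum>j\<in>J. zorder (f j) z * k j)" .
  have mero_g: "?g meromorphic_on {z}"
    using power_product_mero[of k] by (auto simp: nicely_meromorphic_on_def intro: meromorphic_on_subset)
  show ?thesis
    unfolding order[symmetric]
  proof
    assume "?g analytic_on {z}"
    then show "0 \<le> zorder ?g z"
      using g_nz by (intro zorder_ge_0) (simp_all add: eventually_frequently)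
  next
    assume "0 \<le> zorder ?g z"
    moreover have "zorder ?g z < 0" if "is_pole ?g z"
      using that mero_g by (intro isolated_pole_imp_neg_zorder) (simp_all add: meromorphic_at_iff)
    ultimately show "?g analytic_on {z}"
      using nicely_meromorphic_on_imp_analytic_at[OF power_product_mero, of z k] by auto
  qed
qed

end

section \<open>Artin L-functions do not vanish identically\<close>

text \<open>A zero \<open>t\<close> is not 0, where the determinant is 1, and its inverse is an
  eigenvalue of \<open>C\<close>.\<close>

lemma euler_factor_finite_zeros:
  assumes "is_euler_factor n \<rho> p E"
  shows "finite {t. E t = 0}"
proof -
  obtain m C where C: "C \<in> carrier_mat m m"
    and E: "E = (\<lambda>t. Determinant.det (1\<^sub>m m - t \<cdot>\<^sub>m C))"
    using assms unfolding is_euler_factor_def by blast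
  have "t \<in> inverse ` spectrum C" if t: "E t = 0" for t
  proof -
    have "t \<noteq> 0"
    proof
      assume "t = 0"
      then have "1\<^sub>m m - t \<cdot>\<^sub>m C = 1\<^sub>m m"
        using C by (intro eq_matI) auto
      then show False
        using t by (simp add: E)
    qed
    then have "1\<^sub>m m - t \<cdot>\<^sub>m C = (- t) \<cdot>\<^sub>m char_matrix C (inverse t)"
      using C by (intro eq_matI) (auto simp: char_matrix_def field_simps)
    then have "Determinant.det (char_matrix C (inverse t)) = 0"
      using t \<open>t \<noteq> 0\<close> C by (simp add: E det_smult)
    then have "inverse t \<in> spectrum C"
      using eigenvalue_det[OF C] by (simp add: spectrum_def)
    then show ?thesis
      by (metis imageI inverse_inverse_eq)
  qed
  then have "{t. E t = 0} \<subseteq> inverse ` spectrum C"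
    by blast
  then show ?thesis
    using card_finite_spectrum(1)[OF C] finite_subset by blast
qed

text \<open>A product in the sense of \<open>has_prod\<close> is 0 only if some factor is 0. Each
  prime rules out finitely many points of a real interval, and the interval is uncountable.\<close>

lemma artin_L_function_nonzero:
  assumes "is_artin_L_function chi f"
  shows "\<exists>s. f s \<noteq> 0"
proof -
  obtain n and \<rho> :: "('a \<Rightarrow> 'a) \<Rightarrow> complex mat" and E where
    E: "\<And>p. Factorial_Ring.prime p \<Longrightarrow> is_euler_factor n \<rho> p (E p)"
    and prod: "\<And>s. Re s > 1 \<Longrightarrow>
      (\<lambda>p::nat. if Factorial_Ring.prime p then inverse (E p (of_nat p powr (-s))) else 1) has_prod f s"
    using assms unfolding is_artin_L_function_def by blast
  \<comment> \<open>Since \<open>inverse 0 = 0\<close>, these are the points where the factor at a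
    prime \<open>p\<close> vanishes.\<close>
  define bad where "bad p = {x\<in>{2<..<3::real}. E p (of_nat p powr (- of_real x)) = 0}" for p
  have "finite (bad p)" if p: "Factorial_Ring.prime p" for p
  proof -
    have "inj_on (\<lambda>x. complex_of_nat p powr (- of_real x)) {2<..<3}"
    proof (rule inj_onI)
      fix x y assume "complex_of_nat p powr (- of_real x) = of_nat p powr (- of_real y)"
      then have "norm (complex_of_nat p powr (- of_real x)) = norm (complex_of_nat p powr (- of_real y))"
        by simp
      then show "x = y"
        using prime_gt_1_nat[OF p] by (simp add: norm_powr_real_powr powr_inj)
    qed
    then have "finite ((\<lambda>x. complex_of_nat p powr (- of_real x)) -` {t. E p t = 0} \<inter> {2<..<3})"
      by (rule finite_vimage_IntI[OF euler_factor_finite_zeros[OF E[OF p]]])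
    then show ?thesis
      by (rule finite_subset[rotated]) (auto simp: bad_def)
  qed
  then have "countable (\<Union>p\<in>{p. Factorial_Ring.prime p}. bad p)"
    by (intro countable_UN) (auto intro: countable_finite)
  then have "\<not> {2<..<3::real} \<subseteq> (\<Union>p\<in>{p. Factorial_Ring.prime p}. bad p)"
    using uncountable_open_interval[of 2 "3::real"] countable_subset by auto
  then obtain x where "x \<in> {2<..<3}" "x \<notin> (\<Union>p\<in>{p. Factorial_Ring.prime p}. bad p)"
    by blast
  then have x: "2 < x" "\<And>p. Factorial_Ring.prime p \<Longrightarrow> E p (of_nat p powr (- of_real x)) \<noteq> 0"
    by (auto simp: bad_def)
  have "f (of_real x) \<noteq> 0"
    using prod[of "of_real x"] x by (auto simp: has_prod_def raw_has_prod_def split: if_splits)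
  then show ?thesis
    by blast
qed

section \<open>The Riemann zeta function\<close>

lemma summable_Suc_powr: "1 < t \<Longrightarrow> summable (\<lambda>n. real (Suc n) powr - t)"
  using summable_real_powr_iff[of "- t"] summable_Suc_iff[of "\<lambda>n. real n powr - t"] by simp

text \<open>The Weierstrass M-test on small discs. \<open>B\<close> and \<open>c\<close> let it
  cover both the zeta series (\<open>c = 0\<close>) and its Taylor remainders
  (\<open>c = N\<close>).\<close>

lemma powr_dominated_series:
  fixes u :: "nat \<Rightarrow> complex \<Rightarrow> complex" and B :: "complex \<Rightarrow> real"
  assumes S: "open S" and holo: "\<And>n. u n holomorphic_on S" and B: "continuous_on S B"
    and bound: "\<And>n s. s \<in> S \<Longrightarrow> norm (u n s) \<le> B s * real (Suc n) powr - (Re s + c)"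
    and exponent: "\<And>s. s \<in> S \<Longrightarrow> 1 < Re s + c"
  shows powr_dominated_series_summable: "s \<in> S \<Longrightarrow> summable (\<lambda>n. u n s)"
    and powr_dominated_series_holomorphic: "(\<lambda>s. \<Sum>n. u n s) holomorphic_on S"
proof -
  show "summable (\<lambda>n. u n s)" if "s \<in> S"
    by (rule summable_comparison_test'[OF summable_mult[OF summable_Suc_powr[OF exponent[OF that]]]])
      (rule bound[OF that])
  show "(\<lambda>s. \<Sum>n. u n s) holomorphic_on S"
  proof (rule holomorphic_uniform_sequence[OF S])
    show "(\<lambda>s. \<Sum>i<n. u i s) holomorphic_on S" for n
      by (intro holomorphic_intros holo)
  next
    fix x assume x: "x \<in> S"
    \<comment> \<open>Halfway between 1 and \<open>Re x + c\<close>; the radius \<open>d\<close>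
      keeps \<open>Re s + c\<close> at least \<open>t\<close> on the disc.\<close>
    define t where "t = (Re x + c + 1) / 2"
    obtain d0 where d0: "d0 > 0" "cball x d0 \<subseteq> S"
      using S x open_contains_cball by blast
    define d where "d = min d0 (Re x + c - t)"
    have t: "1 < t" and d: "0 < d" "cball x d \<subseteq> S"
      using exponent[OF x] d0 by (auto simp: t_def d_def)
    have "compact (B ` cball x d)"
      using B d(2) by (intro compact_continuous_image) (auto intro: continuous_on_subset)
    then have "bounded (B ` cball x d)"
      by (rule compact_imp_bounded)
    then obtain K where "\<forall>y\<in>B ` cball x d. norm y \<le> K"
      unfolding bounded_iff by blast
    then have K: "norm (B s) \<le> K" if "s \<in> cball x d" for s
      using that by blast
    have "norm (u n s) \<le> K * real (Suc n) powr - t" if s: "s \<in> cball x d" for n s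
    proof -
      have "\<bar>Re x - Re s\<bar> \<le> d"
        using s abs_Re_le_cmod[of "x - s"] by (simp add: dist_norm)
      then have "t \<le> Re s + c"
        by (simp add: d_def abs_le_iff)
      then have "real (Suc n) powr - (Re s + c) \<le> real (Suc n) powr - t"
        by (intro powr_mono) auto
      moreover have "B s \<le> K" "0 \<le> K"
        using K[OF s] by auto
      moreover have "norm (u n s) \<le> B s * real (Suc n) powr - (Re s + c)"
        using bound s d(2) by blast
      ultimately show ?thesis
        by (meson mult_mono order_trans powr_ge_zero)
    qed
    then have "uniform_limit (cball x d) (\<lambda>n s. \<Sum>i<n. u i s) (\<lambda>s. \<Sum>n. u n s) sequentially"
      by (intro Weierstrass_m_test[where M = "\<lambda>n. K * real (Suc n) powr - t"]
          summable_mult summable_Suc_powr t)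
    with d show "\<exists>d>0. cball x d \<subseteq> S \<and>
        uniform_limit (cball x d) (\<lambda>n s. \<Sum>i<n. u i s) (\<lambda>s. \<Sum>n. u n s) sequentially"
      by blast
  qed
qed

definition zeta_series :: "complex \<Rightarrow> complex" where
  "zeta_series s = (\<Sum>n. of_nat (Suc n) powr (- s))"

lemma norm_of_nat_Suc_powr: "norm (complex_of_nat (Suc n) powr s) = real (Suc n) powr Re s"
  by (subst norm_powr_real_powr) auto

lemma
  shows summable_zeta_series: "1 < Re s \<Longrightarrow> summable (\<lambda>n. complex_of_nat (Suc n) powr (- s))"
    and holomorphic_zeta_series: "zeta_series holomorphic_on {s. 1 < Re s}"
proof -
  have S: "open {s. 1 < Re s}"
    by (simp add: open_halfspace_Re_gt)
  have holo: "(\<lambda>s. complex_of_nat (Suc n) powr (- s)) holomorphic_on {s. 1 < Re s}" for n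
    by (intro holomorphic_intros) (auto simp del: of_nat_Suc)
  have bound: "norm (complex_of_nat (Suc n) powr (- s)) \<le> 1 * real (Suc n) powr - (Re s + 0)" for s n
    by (simp add: norm_of_nat_Suc_powr del: of_nat_Suc)
  have exponent: "1 < Re s + 0" if "s \<in> {s. 1 < Re s}" for s
    using that by simp
  note series = powr_dominated_series_summable powr_dominated_series_holomorphic
  note series = series[OF S holo continuous_on_const bound exponent]
  show "summable (\<lambda>n. complex_of_nat (Suc n) powr (- s))" if "1 < Re s"
    using series(1)[of s] that by simp
  show "zeta_series holomorphic_on {s. 1 < Re s}"
    using series(2) by (simp add: zeta_series_def[abs_def])
qed

section \<open>Continuation of zeta by Taylor expansion\<close>

text \<open>The falling factorial; \<open>falling (1 - s) k\<close> is the coefficient in the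
  \<open>k\<close>-th derivative of \<open>x powr (1 - s)\<close>.\<close>

definition falling :: "complex \<Rightarrow> nat \<Rightarrow> complex" where
  "falling a k = (\<Prod>i<k. a - of_nat i)"

text \<open>The error at \<open>n + 2\<close> of the Taylor polynomial of degree \<open>N\<close> of
  \<open>x powr (1 - s)\<close> at \<open>x = n + 1\<close>.\<close>

definition zeta_remainder :: "nat \<Rightarrow> nat \<Rightarrow> complex \<Rightarrow> complex" where
  "zeta_remainder N n s = of_nat (Suc (Suc n)) powr (1 - s) -
     (\<Sum>k\<le>N. falling (1 - s) k / fact k * of_nat (Suc n) powr (1 - s - of_nat k))"

text \<open>Taylor's estimate with increment 1: the norm of the derivative of order
  \<open>N + 1\<close> decreases along the segment, so its value at the left end bounds it.\<close>

lemma zeta_remainder_bound: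
  assumes s: "1 < Re s + real N"
  shows "norm (zeta_remainder N n s)
    \<le> norm (falling (1 - s) (Suc N)) / fact N * real (Suc n) powr - (Re s + real N)"
proof -
  define x :: real where "x = real (Suc n)"
  \<comment> \<open>The \<open>i\<close>-th derivative of \<open>z powr (1 - s)\<close> off the
    nonpositive reals.\<close>
  define F where "F i z = falling (1 - s) i * z powr (1 - s - of_nat i)" for i and z :: complex
  have x: "x > 0"
    by (simp add: x_def)
  have seg: "\<exists>y\<ge>x. z = of_real y" if "z \<in> closed_segment (of_real x) (of_real (x + 1))" for z :: complex
  proof -
    have "z \<in> of_real ` closed_segment x (x + 1)"
      using that by (simp only: closed_segment_of_real)
    then obtain y where "y \<in> closed_segment x (x + 1)" "z = of_real y"
      by (rule imageE)
    then show ?thesis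
      by (auto simp: closed_segment_eq_real_ivl)
  qed
  have "norm (F 0 (of_real (x + 1)) -
          (\<Sum>i\<le>N. F i (of_real x) * (of_real (x + 1) - of_real x) ^ i / fact i))
      \<le> (norm (falling (1 - s) (Suc N)) * x powr - (Re s + real N)) *
          norm (of_real (x + 1) - of_real x :: complex) ^ Suc N / fact N"
  proof (rule complex_Taylor[where S = "closed_segment (of_real x) (of_real (x + 1))"])
    fix i z assume "z \<in> closed_segment (complex_of_real x) (of_real (x + 1))"
    then obtain y where y: "y \<ge> x" "z = of_real y"
      using seg by blast
    then have "z \<notin> \<real>\<^sub>\<le>\<^sub>0"
      using x by simp
    then have "(F i has_field_derivative
        falling (1 - s) i * ((1 - s - of_nat i) * z powr (1 - s - of_nat i - 1))) (at z)"
      unfolding F_def by (intro DERIV_cmult has_field_derivative_powr)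
    then show "(F i has_field_derivative F (Suc i) z)
        (at z within closed_segment (of_real x) (of_real (x + 1)))"
      by (simp add: F_def falling_def algebra_simps has_field_derivative_at_within)
  next
    fix z assume "z \<in> closed_segment (complex_of_real x) (of_real (x + 1))"
    then obtain y where y: "y \<ge> x" "z = of_real y"
      using seg by blast
    then have "norm (z powr (1 - s - of_nat (Suc N))) = y powr - (Re s + real N)"
      using x by (simp add: norm_powr_real_powr)
    also have "\<dots> \<le> x powr - (Re s + real N)"
      using x y s by (intro powr_mono2') auto
    finally show "norm (F (Suc N) z) \<le> norm (falling (1 - s) (Suc N)) * x powr - (Re s + real N)"
      unfolding F_def norm_mult by (rule mult_left_mono) simp
  qed auto
  then show ?thesis
    by (simp add: zeta_remainder_def F_def x_def falling_def add.commute)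
qed

lemma holomorphic_falling [holomorphic_intros]:
  "f holomorphic_on A \<Longrightarrow> (\<lambda>s. falling (f s) k) holomorphic_on A"
  unfolding falling_def by (intro holomorphic_intros)

lemma holomorphic_zeta_remainder:
  "(\<lambda>s. \<Sum>n. zeta_remainder N n s) holomorphic_on {s. 1 < Re s + real N}"
proof -
  let ?S = "{s. 1 < Re s + real N}"
  let ?B = "\<lambda>s. norm (falling (1 - s) (Suc N)) / fact N"
  have "?S = {s. 1 - real N < Re s}"
    by auto
  then have S: "open ?S"
    by (simp only: open_halfspace_Re_gt)
  have holo: "zeta_remainder N n holomorphic_on ?S" for n
    unfolding zeta_remainder_def[abs_def]
    by (intro holomorphic_intros) (auto simp del: of_nat_Suc)
  have B: "continuous_on ?S ?B"
    by (intro continuous_intros holomorphic_on_imp_continuous_on holomorphic_intros) auto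
  have bound: "norm (zeta_remainder N n s) \<le> ?B s * real (Suc n) powr - (Re s + real N)"
    if "s \<in> ?S" for s n
    using that zeta_remainder_bound by blast
  have exponent: "1 < Re s + real N" if "s \<in> ?S" for s
    using that by simp
  show ?thesis
    by (rule powr_dominated_series_holomorphic[OF S holo B bound exponent])
qed

text \<open>
  Expand \<open>(n + 1)\<^sup>1\<^sup>-\<^sup>s\<close> at \<open>n\<close> and sum over \<open>n\<close>: the differences \<open>(n + 1)\<^sup>1\<^sup>-\<^sup>s - n\<^sup>1\<^sup>-\<^sup>s\<close> telescope to \<open>- 1\<close>.
\<close>

lemma zeta_series_recurrence:
  assumes s: "1 < Re s"
  shows "(s - 1) * zeta_series s = 1 + (\<Sum>n. zeta_remainder (Suc N) n s) +
    (\<Sum>j<N. falling (1 - s) (j + 2) / fact (j + 2) * zeta_series (s + of_nat j + 1))"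
proof -
  have "(\<lambda>n. complex_of_nat (Suc n) powr (1 - s)) \<longlonglongrightarrow> 0"
    using s by (intro tendsto_neg_powr_complex_of_nat filterlim_Suc) auto
  then have "(\<lambda>n. of_nat (Suc (Suc n)) powr (1 - s) - of_nat (Suc n) powr (1 - s)) sums
      (0 - complex_of_nat (Suc 0) powr (1 - s))"
    by (rule telescope_sums)
  then have tele: "(\<lambda>n. of_nat (Suc (Suc n)) powr (1 - s) - of_nat (Suc n) powr (1 - s)) sums (- 1 :: complex)"
    by simp
  \<comment> \<open>For \<open>k = j + 1\<close> the Taylor term has exponent
    \<open>1 - s - k = - (s + j)\<close>, so it sums to a shifted zeta value.\<close>
  have zeta: "(\<lambda>n. c * of_nat (Suc n) powr (- (s + of_nat j))) sums (c * zeta_series (s + of_nat j))" for j c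
    unfolding zeta_series_def using s by (intro sums_mult summable_sums summable_zeta_series) auto
  have "(\<lambda>n. (of_nat (Suc (Suc n)) powr (1 - s) - of_nat (Suc n) powr (1 - s)) -
      (\<Sum>j<Suc N. falling (1 - s) (Suc j) / fact (Suc j) * of_nat (Suc n) powr (- (s + of_nat j)))) sums
      (- 1 - (\<Sum>j<Suc N. falling (1 - s) (Suc j) / fact (Suc j) * zeta_series (s + of_nat j)))"
    by (intro sums_diff sums_sum tele zeta)
  moreover have "(of_nat (Suc (Suc n)) powr (1 - s) - of_nat (Suc n) powr (1 - s)) -
      (\<Sum>j<Suc N. falling (1 - s) (Suc j) / fact (Suc j) * of_nat (Suc n) powr (- (s + of_nat j))) =
      zeta_remainder (Suc N) n s" for n
    unfolding zeta_remainder_def sum.atMost_Suc_shift lessThan_Suc_atMost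
    by (simp add: falling_def)
  ultimately have "(\<Sum>n. zeta_remainder (Suc N) n s) =
      - 1 - (\<Sum>j<Suc N. falling (1 - s) (Suc j) / fact (Suc j) * zeta_series (s + of_nat j))"
    by (simp add: sums_iff)
  \<comment> \<open>The term \<open>j = 0\<close> is \<open>(1 - s) * zeta_series s\<close>;
    isolating it gives the left-hand side.\<close>
  then show ?thesis
    unfolding sum.lessThan_Suc_shift
    by (simp add: falling_def[of _ "Suc 0"] algebra_simps)
qed

text \<open>
  The simple pole of \<open>zeta_series (s + j + 1)\<close> at \<open>s = - j\<close> is cancelled by the last factor of
  \<open>falling (1 - s) (j + 2)\<close>, so the recurrence extends the half-plane by 1.
\<close>

lemma zeta_series_continuation:
  "\<exists>g. g holomorphic_on {s. 1 - real M < Re s} \<and> (\<forall>s. 1 < Re s \<longrightarrow> g s = (s - 1) * zeta_series s)"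
proof (induction M)
  case 0
  have "(\<lambda>s. (s - 1) * zeta_series s) holomorphic_on {s. 1 < Re s}"
    by (intro holomorphic_intros holomorphic_zeta_series)
  then show ?case
    by auto
next
  case (Suc M)
  then obtain g where g: "g holomorphic_on {s. 1 - real M < Re s}"
    and g_eq: "\<And>s. 1 < Re s \<Longrightarrow> g s = (s - 1) * zeta_series s"
    by blast
  \<comment> \<open>The recurrence with \<open>g (s + j + 1) / (s + j)\<close> for the zeta values.
    The denominator cancels the last factor \<open>- (s + j)\<close> of
    \<open>falling (1 - s) (j + 2)\<close>, whence the minus sign and the index
    \<open>j + 1\<close>.\<close>
  define h where "h s = 1 + (\<Sum>n. zeta_remainder (Suc M) n s) -
    (\<Sum>j<M. falling (1 - s) (j + 1) / fact (j + 2) * g (s + of_nat j + 1))" for s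
  have "h holomorphic_on {s. 1 - real (Suc M) < Re s}"
  proof -
    have "{s. 1 - real (Suc M) < Re s} = {s. 1 < Re s + real (Suc M)}"
      by auto
    then have "(\<lambda>s. \<Sum>n. zeta_remainder (Suc M) n s) holomorphic_on {s. 1 - real (Suc M) < Re s}"
      using holomorphic_zeta_remainder[of "Suc M"] by (simp only:)
    moreover have "(\<lambda>s. g (s + of_nat j + 1)) holomorphic_on {s. 1 - real (Suc M) < Re s}" for j
    proof -
      have "g \<circ> (\<lambda>s. s + of_nat j + 1) holomorphic_on {s. 1 - real (Suc M) < Re s}"
        using g by (rule holomorphic_on_compose_gen[rotated]) (auto intro!: holomorphic_intros)
      then show ?thesis
        by (simp add: o_def)
    qed
    ultimately show ?thesis
      unfolding h_def[abs_def] by (intro holomorphic_intros) auto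
  qed
  moreover have "h s = (s - 1) * zeta_series s" if s: "1 < Re s" for s
  proof -
    have "falling (1 - s) (j + 2) / fact (j + 2) * zeta_series (s + of_nat j + 1) =
        - (falling (1 - s) (j + 1) / fact (j + 2) * g (s + of_nat j + 1))" for j
    proof -
      have "falling (1 - s) (j + 2) = - (falling (1 - s) (j + 1) * (s + of_nat j))"
        by (simp add: falling_def algebra_simps)
      moreover have "g (s + of_nat j + 1) = (s + of_nat j) * zeta_series (s + of_nat j + 1)"
        using s by (subst g_eq) auto
      ultimately show ?thesis
        by simp
    qed
    then show ?thesis
      using zeta_series_recurrence[OF s, of M] by (simp add: h_def sum_negf)
  qed
  ultimately show ?case
    by blast
qed

text \<open>The identity theorem on a half-plane containing 2 and \<open>s0\<close> identifies
  \<open>f\<close> near \<open>s0\<close> with \<open>g s / (s - 1)\<close>, which has no pole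
  there.\<close>

lemma meromorphic_zeta_analytic:
  assumes f: "f nicely_meromorphic_on UNIV"
    and f_eq: "\<And>s. 1 < Re s \<Longrightarrow> f s = zeta_series s"
    and s0: "s0 \<noteq> 1"
  shows "f analytic_on {s0}"
proof -
  obtain M :: nat where M: "1 - Re s0 < real M"
    using reals_Archimedean2 by blast
  define A where "A = {s. 1 - real (Suc M) < Re s}"
  obtain g where g: "g holomorphic_on A"
    and g_eq: "\<And>s. 1 < Re s \<Longrightarrow> g s = (s - 1) * zeta_series s"
    using zeta_series_continuation[of "Suc M"] unfolding A_def by blast
  have A: "open A" "connected A" "2 \<in> A" "s0 \<in> A"
    using M by (auto simp: A_def open_halfspace_Re_gt convex_halfspace_Re_gt convex_connected)
  \<comment> \<open>\<open>h\<close> may be singular at 1 and at poles of \<open>f\<close>, so the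
    identity theorem is applied to \<open>remove_sings h\<close>.\<close>
  define h where "h s = f s - g s / (s - 1)" for s
  have "g meromorphic_on A"
    using g A(1) by (simp add: analytic_on_imp_meromorphic_on analytic_on_open)
  then have mero: "h meromorphic_on A"
    unfolding h_def[abs_def] using f
    by (intro meromorphic_intros) (auto simp: nicely_meromorphic_on_def intro: meromorphic_on_subset)
  have "\<forall>\<^sub>F s in at (2 :: complex). s \<in> {s. 1 < Re s}"
    by (intro eventually_at_in_open') (auto simp: open_halfspace_Re_gt)
  moreover have "\<forall>\<^sub>F s in at 2. remove_sings h s = h s"
    by (intro eventually_remove_sings_eq_at meromorphic_on_isolated_singularity[OF meromorphic_on_subset[OF mero]])
       (use A in auto)
  ultimately have "\<forall>\<^sub>F s in at 2. remove_sings h s = 0"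
    by eventually_elim (auto simp: h_def f_eq g_eq)
  then have zero: "remove_sings h s = 0" if "s \<in> A" for s
    using frequently_eq_meromorphic_imp_constant[of "remove_sings h" 0 2 A s]
      remove_sings_nicely_meromorphic[OF mero] A that by (simp add: eventually_frequently)
  have "\<forall>\<^sub>F s in at s0. s \<in> A"
    using A by (intro eventually_at_in_open') auto
  moreover have "\<forall>\<^sub>F s in at s0. remove_sings h s = h s"
    by (intro eventually_remove_sings_eq_at meromorphic_on_isolated_singularity[OF meromorphic_on_subset[OF mero]])
       (use A in auto)
  ultimately have "\<forall>\<^sub>F s in at s0. f s = g s / (s - 1)"
    by eventually_elim (use zero in \<open>auto simp: h_def\<close>)
  then have "is_pole f s0 \<longleftrightarrow> is_pole (\<lambda>s. g s / (s - 1)) s0"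
    by (rule is_pole_cong) simp
  moreover have "(\<lambda>s. g s / (s - 1)) analytic_on {s0}"
    using g A s0 by (intro analytic_intros) (auto intro: holomorphic_on_imp_analytic_at)
  ultimately have "\<not> is_pole f s0"
    by (simp add: analytic_at_imp_no_pole)
  then show ?thesis
    using nicely_meromorphic_on_imp_analytic_at[OF f] by simp
qed

section \<open>The Euler product of zeta\<close>

text \<open>Euler's sieve: discarding the multiples of a prime \<open>p\<close> multiplies the sum
  by \<open>1 - a p\<close>, and what survives all primes up to \<open>N\<close> tends to the term
  at 1.\<close>

lemma zeta_euler_product:
  assumes s: "1 < Re s"
    and prod: "(\<lambda>p::nat. if Factorial_Ring.prime p then inverse (1 - of_nat p powr (- s)) else 1) has_prod L"
  shows "L = zeta_series s"
proof -
  define a where "a n = complex_of_nat n powr (- s)" for n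
  \<comment> \<open>The positive integers without prime factors up to \<open>N\<close>;
    \<open>F 0\<close> contains all positive integers.\<close>
  define F where "F N = {n. 0 < n \<and> (\<forall>p\<le>N. Factorial_Ring.prime p \<longrightarrow> \<not> p dvd n)}" for N :: nat
  have norm_a: "norm (a n) = real n powr - Re s" for n
    unfolding a_def by (subst norm_powr_real_powr) auto
  have a_mult: "a (m * n) = a m * a n" for m n
    unfolding a_def of_nat_mult by (intro powr_times_real) auto
  have "summable (\<lambda>n. norm (a n))"
    using s by (simp add: norm_a summable_real_powr_iff)
  then have abs: "(\<lambda>n. norm (a n)) summable_on A" for A
    using summable_on_UNIV_nonneg_real_iff[of "\<lambda>n. norm (a n)"] summable_on_subset_banach[of _ UNIV A]
    by simp
  then have summable: "a summable_on A" for A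
    by (rule abs_summable_summable)
  define Z where "Z = infsum a {n. 0 < n}"
  have Z: "Z = zeta_series s"
  proof -
    have "{n. 0 < n} = range Suc"
      using gr0_conv_Suc by auto
    then have "Z = infsum (a \<circ> Suc) UNIV"
      by (simp add: Z_def infsum_reindex)
    moreover have "((a \<circ> Suc) has_sum infsum (a \<circ> Suc) UNIV) UNIV"
      using summable by (simp add: summable_on_reindex flip: summable_on_reindex)
    ultimately show ?thesis
      by (auto simp: zeta_series_def a_def o_def sums_iff dest!: has_sum_imp_sums)
  qed
  have sieve: "infsum a (F N) = Z * (\<Prod>p\<le>N. if Factorial_Ring.prime p then 1 - a p else 1)" for N
  proof (induction N)
    case 0
    then show ?case
      by (simp add: F_def Z_def)
  next
    case (Suc N)
    show ?case
    proof (cases "Factorial_Ring.prime (Suc N)")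
      case False
      then have "F (Suc N) = F N"
        by (auto simp: F_def le_Suc_eq)
      with False Suc show ?thesis
        by simp
    next
      case True
      let ?p = "Suc N"
      \<comment> \<open>Dividing a multiple of \<open>?p\<close> in \<open>F N\<close> by
        \<open>?p\<close> stays in \<open>F N\<close>; conversely, a smaller prime dividing
        \<open>?p * m\<close> divides \<open>m\<close>.\<close>
      have "F N = F ?p \<union> (*) ?p ` F N"
      proof (intro equalityI subsetI)
        fix n assume n: "n \<in> F N"
        show "n \<in> F ?p \<union> (*) ?p ` F N"
        proof (cases "?p dvd n")
          case True
          then obtain m where "n = ?p * m" ..
          with n have "m \<in> F N"
            by (auto simp: F_def)
          with \<open>n = ?p * m\<close> show ?thesis
            by blast
        qed (use n in \<open>auto simp: F_def le_Suc_eq\<close>)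
      next
        fix n assume "n \<in> F ?p \<union> (*) ?p ` F N"
        then show "n \<in> F N"
        proof
          assume "n \<in> (*) ?p ` F N"
          then obtain m where m: "m \<in> F N" "n = ?p * m" ..
          have "\<not> q dvd n" if q: "q \<le> N" "Factorial_Ring.prime q" for q
          proof
            assume "q dvd n"
            then have "q dvd ?p \<or> q dvd m"
              using q(2) m(2) prime_dvd_mult_iff by blast
            moreover have "\<not> q dvd m"
              using q m(1) by (simp add: F_def)
            ultimately show False
              using primes_dvd_imp_eq[OF q(2) True] q(1) by simp
          qed
          with m show ?thesis
            by (auto simp: F_def)
        qed (auto simp: F_def)
      qed
      moreover have "n \<notin> F ?p" if "n \<in> (*) ?p ` F N" for n
      proof -
        from that have "?p dvd n"
          using dvd_triv_left by blast
        with True show ?thesis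
          unfolding F_def by blast
      qed
      then have "F ?p \<inter> (*) ?p ` F N = {}"
        by blast
      ultimately have "infsum a (F N) = infsum a (F ?p) + infsum a ((*) ?p ` F N)"
        using infsum_Un_disjoint[of a "F ?p" "(*) ?p ` F N"] summable by simp
      moreover have "infsum a ((*) ?p ` F N) = infsum (\<lambda>n. a ?p * a n) (F N)"
        by (subst infsum_reindex) (simp_all add: inj_on_def o_def a_mult del: mult_Suc)
      moreover have "infsum (\<lambda>n. a ?p * a n) (F N) = a ?p * infsum a (F N)"
        by (rule infsum_cmult_right')
      ultimately have "infsum a (F ?p) = infsum a (F N) * (1 - a ?p)"
        by (simp add: algebra_simps)
      with True Suc show ?thesis
        by simp
    qed
  qed
  have factor_nz: "1 - a p \<noteq> 0" if "Factorial_Ring.prime p" for p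
  proof
    assume "1 - a p = 0"
    then have "real p powr - Re s = 1"
      using norm_a[of p] by simp
    moreover have "real p powr - Re s < real p powr 0"
      using s prime_gt_1_nat[OF that] by (intro powr_less_mono) auto
    ultimately show False
      using prime_gt_0_nat[OF that] by simp
  qed
  have "infsum a (F N) * (\<Prod>p\<le>N. if Factorial_Ring.prime p then inverse (1 - a p) else 1) = Z" for N
  proof -
    have "(\<Prod>p\<le>N. if Factorial_Ring.prime p then 1 - a p else 1) *
        (\<Prod>p\<le>N. if Factorial_Ring.prime p then inverse (1 - a p) else 1) = 1"
      unfolding prod.distrib[symmetric] using factor_nz by (intro prod.neutral) auto
    then show ?thesis
      by (simp add: sieve mult.assoc)
  qed
  moreover have "(\<lambda>N. infsum a (F N)) \<longlonglongrightarrow> 1"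
  proof -
    define T where "T = infsum (\<lambda>n. norm (a n)) UNIV"
    \<comment> \<open>Apart from 1, the elements of \<open>F N\<close> exceed \<open>N\<close>, so a
      tail of the absolutely convergent series bounds the difference.\<close>
    have "norm (infsum a (F N) - 1) \<le> T - (\<Sum>n\<le>N. norm (a n))" if N: "1 \<le> N" for N
    proof -
      have F_eq: "F N = {1} \<union> (F N - {1})"
        by (auto simp: F_def dest: prime_gt_1_nat)
      have "F N - {1} \<subseteq> - {..N}"
      proof
        fix n assume n: "n \<in> F N - {1}"
        then obtain p where p: "Factorial_Ring.prime p" "p dvd n"
          using prime_factor_nat[of n] by auto
        then have "\<not> p \<le> N" "p \<le> n"
          using n by (auto simp: F_def intro: dvd_imp_le)
        then show "n \<in> - {..N}"
          by simp
      qed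
      have "infsum a (F N) = infsum a {1} + infsum a (F N - {1})"
        by (subst F_eq, rule infsum_Un_disjoint) (auto simp: summable)
      then have "norm (infsum a (F N) - 1) = norm (infsum a (F N - {1}))"
        by (simp add: a_def)
      also have "\<dots> \<le> infsum (\<lambda>n. norm (a n)) (F N - {1})"
        by (rule norm_infsum_bound) (rule abs)
      also have "\<dots> \<le> infsum (\<lambda>n. norm (a n)) (- {..N})"
        using \<open>F N - {1} \<subseteq> - {..N}\<close> by (intro infsum_mono2 abs) auto
      also have "\<dots> = T - (\<Sum>n\<le>N. norm (a n))"
      proof -
        have "infsum (\<lambda>n. norm (a n)) ({..N} \<union> - {..N}) =
            infsum (\<lambda>n. norm (a n)) {..N} + infsum (\<lambda>n. norm (a n)) (- {..N})"
          by (intro infsum_Un_disjoint abs) auto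
        then have "T = infsum (\<lambda>n. norm (a n)) {..N} + infsum (\<lambda>n. norm (a n)) (- {..N})"
          unfolding T_def by (simp only: Compl_partition)
        then show ?thesis
          by simp
      qed
      finally show ?thesis .
    qed
    then have "\<forall>\<^sub>F N in sequentially. norm (infsum a (F N) - 1) \<le> T - (\<Sum>n\<le>N. norm (a n))"
      using eventually_at_top_linorder by blast
    moreover have "(\<lambda>n. norm (a n)) sums T"
      unfolding T_def using abs by (intro has_sum_imp_sums has_sum_infsum)
    then have "(\<lambda>N. T - (\<Sum>n\<le>N. norm (a n))) \<longlonglongrightarrow> T - T"
      by (intro tendsto_diff tendsto_const) (simp add: sums_def_le)
    ultimately have "(\<lambda>N. infsum a (F N) - 1) \<longlonglongrightarrow> 0"
      using Lim_null_comparison by force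
    then show ?thesis
      by (simp add: LIM_zero_iff)
  qed
  moreover have "(\<lambda>N. \<Prod>p\<le>N. if Factorial_Ring.prime p then inverse (1 - a p) else 1) \<longlonglongrightarrow> L"
    unfolding a_def by (rule has_prod_imp_tendsto[OF prod])
  ultimately have "(\<lambda>N. Z) \<longlonglongrightarrow> 1 * L"
    using tendsto_mult by fastforce
  then have "Z = 1 * L"
    by (simp only: LIMSEQ_const_iff)
  with Z show ?thesis
    by simp
qed

section \<open>The trivial character\<close>

text \<open>Identifies the only character when \<open>r = 1\<close>. Any nonzero vector of a
  one-dimensional space spans it.\<close>

lemma trivial_character_irreducible:
  "(restrict (\<lambda>_. 1) galois_group :: ('k::field_char_0 \<Rightarrow> 'k) \<Rightarrow> complex) \<in> irreducible_characters"
proof -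
  define \<rho> :: "('k::field_char_0 \<Rightarrow> 'k) \<Rightarrow> complex mat" where "\<rho> = (\<lambda>_. 1\<^sub>m 1)"
  have "W = {0\<^sub>v 1} \<or> W = carrier_vec 1" if W: "invariant_subspace 1 \<rho> W" for W
  proof (rule disjCI)
    assume "W \<noteq> carrier_vec 1"
    then obtain w where w: "w \<in> carrier_vec 1" "w \<notin> W"
      using W by (auto simp: invariant_subspace_def)
    have "v = 0\<^sub>v 1" if v: "v \<in> W" for v
    proof (rule ccontr)
      assume neq: "v \<noteq> 0\<^sub>v 1"
      have "v \<in> carrier_vec 1"
        using v W by (auto simp: invariant_subspace_def)
      with neq have "v $ 0 \<noteq> 0"
        by (metis One_nat_def carrier_vecD eq_vecI index_zero_vec less_Suc0)
      then have "w = (w $ 0 / v $ 0) \<cdot>\<^sub>v v"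
        using w \<open>v \<in> carrier_vec 1\<close> by (intro eq_vecI) auto
      then show False
        using w v W unfolding invariant_subspace_def by metis
    qed
    then show "W = {0\<^sub>v 1}"
      using W by (auto simp: invariant_subspace_def)
  qed
  then have "irreducible_representation 1 \<rho>"
    by (auto simp: irreducible_representation_def representation_def \<rho>_def)
  moreover have "rep_character 1 \<rho> = restrict (\<lambda>_. 1) galois_group"
    by (simp add: rep_character_def \<rho>_def)
  ultimately show ?thesis
    unfolding irreducible_characters_def by (metis (mono_tags, lifting) mem_Collect_eq)
qed

text \<open>A linear bijection onto a line starts from a line: for \<open>m > 1\<close>, multiples
  of two unit vectors, scaled crosswise by the entries of \<open>B\<close>, would have the same
  image.\<close>

lemma injective_row_dim:
  fixes B :: "complex mat"
  assumes B: "B \<in> carrier_mat 1 m"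
    and bij: "bij_betw (\<lambda>v. B *\<^sub>v v) (carrier_vec m) (carrier_vec 1)"
  shows "m = 1" "B $$ (0, 0) \<noteq> 0"
proof -
  have inj: "v = w" if "v \<in> carrier_vec m" "w \<in> carrier_vec m" "(B *\<^sub>v v) $ 0 = (B *\<^sub>v w) $ 0" for v w
  proof -
    have "B *\<^sub>v v = B *\<^sub>v w"
      using B that by (intro eq_vecI) auto
    then show ?thesis
      using bij that unfolding bij_betw_def inj_on_def by blast
  qed
  have unit: "(B *\<^sub>v (c \<cdot>\<^sub>v unit_vec m i)) $ 0 = c * B $$ (0, i)" if "i < m" for c i
    using B that by (simp add: mult_mat_vec[where nr = 1 and nc = m])
  have zero: "(B *\<^sub>v (0\<^sub>v m)) $ 0 = 0"
    using B by (simp add: scalar_prod_def)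
  have nz: "B $$ (0, i) \<noteq> 0" if "i < m" for i
  proof
    assume "B $$ (0, i) = 0"
    then have "(1 :: complex) \<cdot>\<^sub>v unit_vec m i = 0\<^sub>v m"
      using that unit[OF that, of 1] zero \<open>B $$ (0, i) = 0\<close> by (intro inj) simp_all
    then have "(1 \<cdot>\<^sub>v unit_vec m i :: complex vec) $ i = 0\<^sub>v m $ i"
      by simp
    then show False
      using that by simp
  qed
  have "m \<noteq> 0"
  proof
    assume "m = 0"
    have "vec 1 (\<lambda>_. 1) \<in> (\<lambda>v. B *\<^sub>v v) ` carrier_vec m"
      using bij unfolding bij_betw_def by auto
    then obtain v where v: "v \<in> carrier_vec m" "vec 1 (\<lambda>_. 1) = B *\<^sub>v v"
      by blast
    then have "v = 0\<^sub>v m"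
      using \<open>m = 0\<close> by (intro eq_vecI) auto
    with v(2) zero have "vec 1 (\<lambda>_. 1) $ 0 = (0 :: complex)"
      by simp
    then show False
      by simp
  qed
  moreover have "\<not> 1 < m"
  proof
    assume m: "1 < m"
    then have "B $$ (0, 1) \<cdot>\<^sub>v unit_vec m 0 = B $$ (0, 0) \<cdot>\<^sub>v unit_vec m 1"
      by (intro inj) (simp_all add: unit)
    then have "(B $$ (0, 1) \<cdot>\<^sub>v unit_vec m 0) $ 0 = (B $$ (0, 0) \<cdot>\<^sub>v unit_vec m 1) $ 0"
      by simp
    then show False
      using m nz[of 1] by simp
  qed
  ultimately show "m = 1"
    by simp
  then show "B $$ (0, 0) \<noteq> 0"
    using nz by simp
qed

text \<open>The character value at \<open>id\<close> is the degree, so \<open>n = 1\<close>, and a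
  matrix of size 1 is its trace. Hence inertia fixes every vector and \<open>C\<close> is the
  identity of size 1.\<close>

lemma trivial_euler_factor:
  fixes \<rho> :: "('k::field_char_0 \<Rightarrow> 'k) \<Rightarrow> complex mat"
  assumes rep: "representation n \<rho>"
    and character: "rep_character n \<rho> = restrict (\<lambda>_. 1) galois_group"
    and euler: "is_euler_factor n \<rho> p E"
  shows "E t = 1 - t"
proof -
  have "(id :: 'k \<Rightarrow> 'k) \<in> galois_group"
    by (simp add: galois_group_def)
  then have "(\<Sum>i<n. \<rho> id $$ (i, i)) = 1"
    using fun_cong[OF character, of id] by (simp add: rep_character_def)
  then have n: "n = 1"
    using rep by (simp add: representation_def)
  have \<rho>: "\<rho> \<sigma> = 1\<^sub>m 1" if "\<sigma> \<in> galois_group" for \<sigma>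
  proof -
    have "\<rho> \<sigma> $$ (0, 0) = 1"
      using fun_cong[OF character, of \<sigma>] that by (simp add: rep_character_def n)
    then show ?thesis
      using rep that by (intro eq_matI) (auto simp: representation_def n)
  qed
  obtain P \<phi> m B C where \<phi>: "is_frobenius p P \<phi>" and B: "B \<in> carrier_mat 1 m"
    and bij: "bij_betw (\<lambda>v. B *\<^sub>v v) (carrier_vec m) (inertia_invariants 1 \<rho> P)"
    and C: "C \<in> carrier_mat m m" and BC: "\<rho> \<phi> * B = B * C"
    and E: "E = (\<lambda>t. Determinant.det (1\<^sub>m m - t \<cdot>\<^sub>m C))"
    using euler unfolding is_euler_factor_def n by blast
  have "\<rho> \<tau> *\<^sub>v v = v" if "\<tau> \<in> inertia_group P" "v \<in> carrier_vec 1" for \<tau> v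
    using that \<rho>[of \<tau>] by (simp add: inertia_group_def decomposition_group_def)
  then have "inertia_invariants 1 \<rho> P = carrier_vec 1"
    by (auto simp: inertia_invariants_def)
  then have m: "m = 1" and b: "B $$ (0, 0) \<noteq> 0"
    using injective_row_dim[OF B] bij by auto
  have "\<phi> \<in> galois_group"
    using \<phi> by (simp add: is_frobenius_def decomposition_group_def)
  then have "B = B * C"
    using \<rho>[of \<phi>] BC B by simp
  then have "B $$ (0, 0) = (B * C) $$ (0, 0)"
    by simp
  also have "\<dots> = B $$ (0, 0) * C $$ (0, 0)"
    using B C m by (simp add: scalar_prod_def)
  finally have "C $$ (0, 0) = 1"
    using b by simp
  then have "1\<^sub>m m - t \<cdot>\<^sub>m C = (1 - t) \<cdot>\<^sub>m 1\<^sub>m 1"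
    using C m by (intro eq_matI) auto
  then show ?thesis
    by (simp add: E)
qed

lemma trivial_L_function_analytic:
  assumes L: "is_artin_L_function (restrict (\<lambda>_. 1) (galois_group :: ('k::field_char_0 \<Rightarrow> 'k) set)) f"
    and s0: "s0 \<noteq> 1"
  shows "f analytic_on {s0}"
proof -
  obtain n and \<rho> :: "('k \<Rightarrow> 'k) \<Rightarrow> complex mat" and E where
    rep: "representation n \<rho>" "rep_character n \<rho> = restrict (\<lambda>_. 1) galois_group"
    and E: "\<And>p. Factorial_Ring.prime p \<Longrightarrow> is_euler_factor n \<rho> p (E p)"
    and prod: "\<And>s. Re s > 1 \<Longrightarrow>
      (\<lambda>p::nat. if Factorial_Ring.prime p then inverse (E p (of_nat p powr (-s))) else 1) has_prod f s"
    using L unfolding is_artin_L_function_def by blast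
  have "(\<lambda>p::nat. if Factorial_Ring.prime p then inverse (E p (of_nat p powr (-s))) else 1) =
      (\<lambda>p. if Factorial_Ring.prime p then inverse (1 - of_nat p powr (-s)) else 1)" for s
    using trivial_euler_factor[OF rep E] by auto
  then have "f s = zeta_series s" if "1 < Re s" for s
    using zeta_euler_product[OF that] prod[OF that] by simp
  then show ?thesis
    using L s0 by (intro meromorphic_zeta_analytic) (auto simp: is_artin_L_function_def)
qed

section \<open>Factoriality and Artin's conjecture\<close>

text \<open>The equivalence with (iii) is restricted to \<open>r > 1\<close>: for
  \<open>r = 1\<close> no \<open>m\<close> with \<open>1 \<le> m < r\<close> exists, whereas (i)
  holds by the continuation of zeta.\<close>

theorem theorem1:
  fixes chi :: "nat \<Rightarrow> ('k::field_char_0 \<Rightarrow> 'k) \<Rightarrow> complex"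
    and f :: "nat \<Rightarrow> complex \<Rightarrow> complex"
    and r :: nat and s0 :: complex
  assumes galois: "finite_galois_over_rat TYPE('k)"
    and characters: "bij_betw chi {1..r} irreducible_characters"
    and L_functions: "\<And>j. j \<in> {1..r} \<Longrightarrow> is_artin_L_function (chi j) (f j)"
    and independent: "multiplicatively_independent f {1..r}"
    and s0: "s0 \<noteq> 1"
  shows
    "(carrier (Hol r f s0) = carrier (Ar r f) \<longleftrightarrow>
       factorial_monoid (Hol r f s0) \<and>
       (\<forall>k\<in>{1..r}. \<forall>l\<in>{1..r}. k \<noteq> l \<longrightarrow>
          (\<exists>g\<in>carrier (Hol r f s0). f k divides\<^bsub>Ar r f\<^esub> g \<and> \<not> f l divides\<^bsub>Ar r f\<^esub> g))) \<and>
     (r > 1 \<longrightarrow>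
       (carrier (Hol r f s0) = carrier (Ar r f) \<longleftrightarrow>
          factorial_monoid (Hol r f s0) \<and>
          (\<exists>m::nat. 1 \<le> m \<and> m < r \<and>
             (\<forall>M. M \<subseteq> {1..r} \<and> card M = m \<longrightarrow>
                (\<exists>k. (\<forall>j\<in>M. k j > 0) \<and> power_product f M k \<in> carrier (Hol r f s0))))))"
proof -
  note One_nat_def [simp del]
  define n where "n j = zorder (f j) s0" for j
  let ?J = "{1..r}"
  let ?P = "power_product f {1..r}"
  have mero: "f j nicely_meromorphic_on UNIV" if "j \<in> ?J" for j
    using L_functions[OF that] by (simp add: is_artin_L_function_def)
  interpret meromorphic_family ?J f
    using mero artin_L_function_nonzero[OF L_functions] by unfold_locales auto
  interpret A: weighted_monoid "Ar r f" ?J "\<lambda>_. 0" ?P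
    by unfold_locales
      (auto simp: Ar_def power_product_mult power_product_zero power_product_eq_iff[OF independent])
  \<comment> \<open>By \<open>power_product_analytic_iff\<close>, holomorphy at \<open>s0\<close>
    means that the weight formed with the orders \<open>n j\<close> is nonnegative.\<close>
  interpret H: weighted_monoid "Hol r f s0" ?J n ?P
    by unfold_locales
      (auto simp: Hol_def Ar_def power_product_mult power_product_zero n_def
        power_product_analytic_iff power_product_eq_iff[OF independent])
  define e where "e j = (\<lambda>i. if i = j then 1 else 0 :: int)" for j :: nat
  have f_eq: "f j = ?P (e j)" if "j \<in> ?J" for j
    using power_product_single[of f j, OF mero[OF that]] power_product_subset[of ?J "{j}" f "\<lambda>_. 1"] that
    by (simp add: e_def)
  have weight_e: "H.weight (e j) = n j" if "j \<in> ?J" for j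
    using H.weight_single[OF that, of 1] by (simp add: e_def)
  have f_dvd: "f j divides\<^bsub>Ar r f\<^esub> ?P k \<longleftrightarrow> (\<forall>i\<in>?J. e j i \<le> k i)" if "j \<in> ?J" for j k
    using that by (simp add: f_eq A.divides_iff A.weight_def)
  have f_Hol: "f j \<in> carrier (Hol r f s0) \<longleftrightarrow> 0 \<le> n j" if "j \<in> ?J" for j
    using that by (simp add: f_eq H.mem_carrier_iff H.admissible_def weight_e) (simp add: e_def)
  have f_Ar: "f j \<in> carrier (Ar r f)" if "j \<in> ?J" for j
    using that by (simp add: f_eq A.mem_carrier_iff A.admissible_def A.weight_def) (simp add: e_def)
  have i_iff: "carrier (Hol r f s0) = carrier (Ar r f) \<longleftrightarrow> (\<forall>j\<in>?J. 0 \<le> n j)"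
  proof
    assume eq: "carrier (Hol r f s0) = carrier (Ar r f)"
    show "\<forall>j\<in>?J. 0 \<le> n j"
    proof
      fix j assume "j \<in> ?J"
      with f_Hol f_Ar eq show "0 \<le> n j"
        by simp
    qed
  next
    assume "\<forall>j\<in>?J. 0 \<le> n j"
    then have "0 \<le> H.weight k" if "\<forall>j\<in>?J. 0 \<le> k j" for k
      using that by (auto simp: H.weight_def intro!: sum_nonneg)
    then show "carrier (Hol r f s0) = carrier (Ar r f)"
      unfolding H.carrier_eq A.carrier_eq by (auto simp: H.weight_def)
  qed
  have i_imp_factorial: "factorial_monoid (Hol r f s0)" if "\<forall>j\<in>?J. 0 \<le> n j"
    using that by (intro H.factorial_if_nonneg) auto
  have i_imp_ii: "\<exists>g\<in>carrier (Hol r f s0). f k divides\<^bsub>Ar r f\<^esub> g \<and> \<not> f l divides\<^bsub>Ar r f\<^esub> g"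
    if "\<forall>j\<in>?J. 0 \<le> n j" "k \<in> ?J" "l \<in> ?J" "k \<noteq> l" for k l
  proof (rule bexI)
    show "f k \<in> carrier (Hol r f s0)"
      using that f_Hol by simp
    have "f k divides\<^bsub>Ar r f\<^esub> ?P (e k)" "\<not> f l divides\<^bsub>Ar r f\<^esub> ?P (e k)"
      using that by (auto simp: f_dvd) (auto simp: e_def)
    then show "f k divides\<^bsub>Ar r f\<^esub> f k \<and> \<not> f l divides\<^bsub>Ar r f\<^esub> f k"
      using f_eq[OF that(2)] by simp
  qed
  have ii_imp_i: "0 \<le> n l"
    if fact: "factorial_monoid (Hol r f s0)" and l: "l \<in> ?J"
      and separate: "\<forall>k\<in>{1..r}. \<forall>l\<in>{1..r}. k \<noteq> l \<longrightarrow>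
        (\<exists>g\<in>carrier (Hol r f s0). f k divides\<^bsub>Ar r f\<^esub> g \<and> \<not> f l divides\<^bsub>Ar r f\<^esub> g)" for l
  proof (cases "r = 1")
    case True
    \<comment> \<open>A single irreducible character must be the trivial one.\<close>
    have "restrict (\<lambda>_. 1) galois_group = chi 1"
      using trivial_character_irreducible[where 'k = 'k] characters True by (auto simp: bij_betw_def)
    then have "f 1 analytic_on {s0}"
      using L_functions[of 1] True trivial_L_function_analytic[OF _ s0, of "f 1", where 'k = 'k] by simp
    then show ?thesis
      using f_Hol[of 1] f_Ar[of 1] l True by (simp add: Hol_def)
  next
    case False
    show ?thesis
    proof (rule ccontr)
      assume "\<not> 0 \<le> n l"
      then have neg: "n l < 0"
        by simp
      have card: "2 \<le> card ?J"
        using False l by auto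
      obtain i where i: "i \<in> ?J" "i \<noteq> l"
        and escape: "\<forall>k. 0 < k l \<and> k i = 0 \<and> (\<forall>j\<in>?J. 0 \<le> k j) \<longrightarrow> H.weight k < 0"
        by (rule H.positive_weight_escape[OF fact card l neg])
      \<comment> \<open>Separating \<open>f l\<close> from \<open>f i\<close> gives an element with
        positive exponent at \<open>l\<close> and exponent 0 at \<open>i\<close>, which has negative
        weight.\<close>
      obtain g where g: "g \<in> carrier (Hol r f s0)" "f l divides\<^bsub>Ar r f\<^esub> g" "\<not> f i divides\<^bsub>Ar r f\<^esub> g"
        using separate[rule_format, OF l i(1) i(2)[symmetric]] by (elim bexE conjE)
      obtain k where k: "g = ?P k" "H.admissible k"
        using g(1) by (rule H.carrierE)
      have nonneg: "0 \<le> k j" if "j \<in> ?J" for j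
        using k(2) that by (simp add: H.admissible_def)
      have "e l l \<le> k l"
        using g(2) l unfolding k(1) f_dvd[OF l] by blast
      then have "0 < k l"
        by (simp add: e_def)
      moreover have "k i = 0"
      proof (rule ccontr)
        assume "k i \<noteq> 0"
        then have "\<forall>j\<in>?J. e i j \<le> k j"
          using nonneg nonneg[OF i(1)] by (auto simp: e_def)
        with g(3) show False
          by (simp add: k(1) f_dvd[OF i(1)])
      qed
      ultimately show False
        using escape[rule_format, of k] nonneg k(2) by (simp add: H.admissible_def)
    qed
  qed
  \<comment> \<open>Under Artin's conjecture \<open>m = 1\<close> works, with the single factors
    \<open>f j\<close> themselves.\<close>
  have i_imp_iii: "\<exists>k. (\<forall>j\<in>M. k j > 0) \<and> power_product f M k \<in> carrier (Hol r f s0)"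
    if nonneg: "\<forall>j\<in>?J. 0 \<le> n j" and M: "M \<subseteq> ?J" "card M = 1" for M
  proof -
    obtain j where j: "M = {j}"
      using M(2) by (rule card_1_singletonE)
    then have "power_product f M (\<lambda>_. 1) \<in> carrier (Hol r f s0)"
      using nonneg M(1) mero f_Hol by (simp add: power_product_single)
    then show ?thesis
      by (intro exI[of _ "\<lambda>_. 1"]) simp
  qed
  have iii_imp_i: "0 \<le> n l"
    if fact: "factorial_monoid (Hol r f s0)" and l: "l \<in> ?J" and m: "1 \<le> m" "m < r"
      and products: "\<forall>M. M \<subseteq> {1..r} \<and> card M = m \<longrightarrow>
        (\<exists>k. (\<forall>j\<in>M. k j > 0) \<and> power_product f M k \<in> carrier (Hol r f s0))" for l m
  proof (rule ccontr)
    assume "\<not> 0 \<le> n l"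
    then have neg: "n l < 0"
      by simp
    have card: "2 \<le> card ?J"
      using m l by auto
    obtain i where i: "i \<in> ?J" "i \<noteq> l"
      and escape: "\<forall>k. 0 < k l \<and> k i = 0 \<and> (\<forall>j\<in>?J. 0 \<le> k j) \<longrightarrow> H.weight k < 0"
      by (rule H.positive_weight_escape[OF fact card l neg])
    \<comment> \<open>As \<open>m < r\<close>, there is room for a set of \<open>m\<close> indices
      that contains \<open>l\<close> and avoids \<open>i\<close>.\<close>
    have "m - 1 \<le> card (?J - {i, l})"
      using i l m by (subst card_Diff_subset) auto
    then obtain M where M: "M \<subseteq> ?J - {i, l}" "card M = m - 1" "finite M"
      by (rule obtain_subset_with_card_n)
    have "insert l M \<subseteq> ?J \<and> card (insert l M) = m"
      using M l m by (subst card_insert_disjoint) auto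
    from products[rule_format, OF this] obtain k where k: "\<forall>j\<in>insert l M. k j > 0"
      "power_product f (insert l M) k \<in> carrier (Hol r f s0)"
      by (elim exE conjE)
    \<comment> \<open>Extension by 0, so that the exponent at \<open>i\<close> is 0 as the
      obstruction requires.\<close>
    define k' where "k' j = (if j \<in> insert l M then k j else 0)" for j
    have "power_product f (insert l M) k = ?P k'"
      using M l unfolding k'_def by (intro power_product_subset) auto
    with k(2) have "H.admissible k'"
      by (simp add: H.mem_carrier_iff)
    moreover have "H.weight k' < 0"
      using k(1) M i by (intro escape[rule_format]) (auto simp: k'_def less_imp_le)
    ultimately show False
      by (simp add: H.admissible_def)
  qed
  let ?i = "\<forall>j\<in>?J. 0 \<le> n j"
  let ?ii = "\<forall>k\<in>{1..r}. \<forall>l\<in>{1..r}. k \<noteq> l \<longrightarrow>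
    (\<exists>g\<in>carrier (Hol r f s0). f k divides\<^bsub>Ar r f\<^esub> g \<and> \<not> f l divides\<^bsub>Ar r f\<^esub> g)"
  let ?iii = "\<lambda>m. \<forall>M. M \<subseteq> {1..r} \<and> card M = m \<longrightarrow>
    (\<exists>k. (\<forall>j\<in>M. k j > 0) \<and> power_product f M k \<in> carrier (Hol r f s0))"
  have "?i \<longleftrightarrow> factorial_monoid (Hol r f s0) \<and> ?ii"
  proof
    assume ?i
    show "factorial_monoid (Hol r f s0) \<and> ?ii"
      using i_imp_factorial[OF \<open>?i\<close>] i_imp_ii[OF \<open>?i\<close>] by (intro conjI ballI impI)
  next
    assume *: "factorial_monoid (Hol r f s0) \<and> ?ii"
    show ?i
      using ii_imp_i[OF conjunct1[OF *] _ conjunct2[OF *]] by (rule ballI)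
  qed
  moreover have "?i \<longleftrightarrow> factorial_monoid (Hol r f s0) \<and> (\<exists>m::nat. 1 \<le> m \<and> m < r \<and> ?iii m)"
    if "1 < r"
  proof
    assume ?i
    have "?iii 1"
      using i_imp_iii[OF \<open>?i\<close>] by (intro allI impI) (elim conjE)
    with \<open>1 < r\<close> have "\<exists>m::nat. 1 \<le> m \<and> m < r \<and> ?iii m"
      by (intro exI[of _ 1] conjI) simp_all
    then show "factorial_monoid (Hol r f s0) \<and> (\<exists>m::nat. 1 \<le> m \<and> m < r \<and> ?iii m)"
      using i_imp_factorial[OF \<open>?i\<close>] by (intro conjI)
  next
    assume *: "factorial_monoid (Hol r f s0) \<and> (\<exists>m::nat. 1 \<le> m \<and> m < r \<and> ?iii m)"
    then obtain m where m: "1 \<le> m" "m < r" "?iii m"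
      by (elim conjE exE)
    show ?i
      using iii_imp_i[OF conjunct1[OF *] _ m] by (rule ballI)
  qed
  ultimately show ?thesis
    unfolding i_iff by (intro conjI impI)
qed

end
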